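(* Let $q$ be a prime power and $n=mt$ with $m,t\ge1$ integers, and let $\beta\in\mathbb{F}_{q^n}$ be a normal basis generator of $\mathbb{F}_{q^n}$ over $\mathbb{F}_q$. Let $V_m$ be the $\mathbb{F}_q$-subalgebra of the composition algebra $\mathbb{F}_{q^n}^\vee\otimes_{\mathbb{F}_q}\mathbb{F}_{q^n}$ formed by all elements of the form \[\sum_{i=0}^{n-1}T_{\beta^{q^i}}\otimes\alpha_i,\] where the ordered set $\{\alpha_i\}_{i=0}^{n-1}\subseteq\mathbb{F}_{q^n}$ is of the form \[\{\alpha_0,\ldots,\alpha_{m-1},\alpha_0^{q^m},\ldots,\alpha_{m-1}^{q^m},\ldots,\alpha_0^{q^{(t-1)m}},\ldots,\alpha_{m-1}^{q^{(t-1)m}}\},\] i.e. $\alpha_{jm+k}=\alpha_k^{q^{jm}}$ for $0\le j\le t-1$, $0\le k\le m-1$. Then there is an isomorphism of $\mathbb{F}_q$-algebras \[\mathscr{L}_n(\mathbb{F}_{q^m})\cong V_m.\]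
   Context: $\mathscr{L}_n(\mathbb{F}_{q^n})$ is the $\mathbb{F}_q$-algebra of linearized polynomials $\sum_{i=0}^{n-1}a_ix^{q^i}\in\mathbb{F}_{q^n}[x]/(x^{q^n}-x)$, $a_i\in\mathbb{F}_{q^n}$, with addition, composition as multiplication, and scalar multiplication by $\mathbb{F}_q$. $\mathscr{L}_n(\mathbb{F}_{q^m})$ is its $\mathbb{F}_q$-subalgebra of polynomials with all coefficients $a_i\in\mathbb{F}_{q^m}$. $\mathbb{F}_{q^n}^\vee=\mathrm{Hom}_{\mathbb{F}_q}(\mathbb{F}_{q^n},\mathbb{F}_q)$; the composition algebra $\mathbb{F}_{q^n}^\vee\otimes_{\mathbb{F}_q}\mathbb{F}_{q^n}$ has the multiplication determined by $(l_1\otimes x_1)(l_2\otimes x_2)=l_1(x_2)\,l_2\otimes x_1$, extended by linearity. For $\alpha\in\mathbb{F}_{q^n}$, $T_\alpha\in\mathbb{F}_{q^n}^\vee$ is $T_\alpha(x)=\mathrm{tr}(\alpha x)$, where $\mathrm{tr}$ is the trace from $\mathbb{F}_{q^n}$ to $\mathbb{F}_q$. A normal basis generator is an element $\beta$ such that $\{\beta^{q^i}\}_{i=0}^{n-1}$ is a basis of $\mathbb{F}_{q^n}$ over $\mathbb{F}_q$. *)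

theory Defs
  imports
    "HOL-Computational_Algebra.Polynomial"
    "HOL-Number_Theory.Prime_Powers"
    "HOL-Library.Cardinality"
    "HOL-Library.Poly_Mapping"
    "HOL-Library.Function_Algebras"
    "HOL-Algebra.Subrings"
    "HOL-Algebra.Module"
begin

section \<open>Algebras over a field\<close>

text \<open>
  The scalars form a type \<open>'k\<close>, so that linear maps, spans and linear independence are
  those of the library. An algebra over \<open>'k\<close> is given by a record of type
  \<open>('k, 'v) module\<close>. (The locale \<open>algebra\<close> of \<open>HOL-Algebra\<close> is not applicable: it requires
  commutativity.)
\<close>

definition is_subalgebra :: "'v set \<Rightarrow> ('k, 'v) module \<Rightarrow> bool" where
  "is_subalgebra S A \<longleftrightarrow> subring S A \<and> (\<forall>c. \<forall>x\<in>S. c \<odot>\<^bsub>A\<^esub> x \<in> S)"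

definition algebra_iso :: "('k, 'v) module \<Rightarrow> ('k, 'w) module \<Rightarrow> ('v \<Rightarrow> 'w) set" where
  "algebra_iso A B =
     {h \<in> ring_iso A B. \<forall>c. \<forall>x\<in>carrier A. h (c \<odot>\<^bsub>A\<^esub> x) = c \<odot>\<^bsub>B\<^esub> h x}"


section \<open>The field extension\<close>

text \<open>
  The inclusion of the base field with \<open>q = CARD('k)\<close> elements into the extension field \<open>'a\<close> is
  a homomorphism \<open>\<iota>\<close>; it makes \<open>'a\<close> a vector space with scalar multiplication \<open>scale \<iota>\<close>.
\<close>

definition field_embedding :: "('k::field \<Rightarrow> 'a::field) \<Rightarrow> bool" where
  "field_embedding \<iota> \<longleftrightarrow>
     \<iota> 1 = 1 \<and> (\<forall>x y. \<iota> (x + y) = \<iota> x + \<iota> y) \<and> (\<forall>x y. \<iota> (x * y) = \<iota> x * \<iota> y)"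

definition scale :: "('k::field \<Rightarrow> 'a::field) \<Rightarrow> 'k \<Rightarrow> 'a \<Rightarrow> 'a" where
  "scale \<iota> c x = \<iota> c * x"

text \<open>
  If \<open>CARD('a) = r ^ d\<close> with \<open>d > 0\<close>, the following is the unique subfield of \<open>'a\<close> with \<open>r\<close>
  elements.
\<close>

definition subfield_of_order :: "nat \<Rightarrow> 'a::field set" where
  "subfield_of_order r = {x. x ^ r = x}"

text \<open>
  The trace of the extension of degree \<open>n\<close>. The sum of the conjugates lies in the image of \<open>\<iota>\<close>,
  and the trace is its preimage.
\<close>

definition trace :: "('k::{field,finite} \<Rightarrow> 'a::field) \<Rightarrow> nat \<Rightarrow> 'a \<Rightarrow> 'k" where
  "trace \<iota> n x = (THE c. \<iota> c = (\<Sum>i<n. x ^ (CARD('k) ^ i)))"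

definition normal_basis_generator ::
    "('k::{field,finite} \<Rightarrow> 'a::field) \<Rightarrow> nat \<Rightarrow> 'a \<Rightarrow> bool" where
  "normal_basis_generator \<iota> n \<beta> \<longleftrightarrow>
     inj_on (\<lambda>i. \<beta> ^ (CARD('k) ^ i)) {..<n} \<and>
     \<not> module.dependent (scale \<iota>) ((\<lambda>i. \<beta> ^ (CARD('k) ^ i)) ` {..<n}) \<and>
     module.span (scale \<iota>) ((\<lambda>i. \<beta> ^ (CARD('k) ^ i)) ` {..<n}) = UNIV"


section \<open>Linearized polynomials\<close>

definition linearized_polys :: "nat \<Rightarrow> nat \<Rightarrow> 'a::field set \<Rightarrow> 'a poly set" where
  "linearized_polys q n F =
     {(\<Sum>i<n. Polynomial.monom (a i) (q ^ i)) | a. \<forall>i<n. a i \<in> F}"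

text \<open>
  A residue class modulo \<open>x\<^bsup>q^n\<^esup> - x\<close> is represented by its member of degree less than
  \<open>q ^ n\<close>, so multiplication is composition followed by taking the remainder.
\<close>

definition linearized_algebra ::
    "('k::{field,finite} \<Rightarrow> 'a::{field,finite}) \<Rightarrow> nat \<Rightarrow> ('k, 'a poly) module" where
  "linearized_algebra \<iota> n = \<lparr>
     carrier = linearized_polys CARD('k) n UNIV,
     mult = (\<lambda>f g. pcompose f g mod
       (Polynomial.monom 1 (CARD('k) ^ n) - Polynomial.monom 1 1)),
     one = Polynomial.monom 1 1,
     zero = 0,
     add = (+),
     smult = (\<lambda>c. Polynomial.smult (\<iota> c)) \<rparr>"


section \<open>Tensor products\<close>

text \<open>
  The tensor product of subspaces \<open>V\<close> and \<open>W\<close> is the vector space freely generated by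
  \<open>V \<times> W\<close> modulo the span of the bilinearity relations. Finitely supported functions model
  the free vector space, \<open>single (v, w) 1\<close> being the generator for \<open>(v, w)\<close>.
\<close>

definition free_scale :: "'k::field \<Rightarrow> ('x \<Rightarrow>\<^sub>0 'k) \<Rightarrow> ('x \<Rightarrow>\<^sub>0 'k)" where
  "free_scale c f = Poly_Mapping.map ((*) c) f"

definition free_space :: "'b set \<Rightarrow> 'c set \<Rightarrow> (('b \<times> 'c) \<Rightarrow>\<^sub>0 'k::field) set" where
  "free_space V W = {f. Poly_Mapping.keys f \<subseteq> V \<times> W}"

abbreviation gen :: "'b \<Rightarrow> 'c \<Rightarrow> (('b \<times> 'c) \<Rightarrow>\<^sub>0 'k::field)" where
  "gen v w \<equiv> Poly_Mapping.single (v, w) 1"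

definition bilinear_relations ::
    "('k::field \<Rightarrow> 'b::ab_group_add \<Rightarrow> 'b) \<Rightarrow> ('k \<Rightarrow> 'c::ab_group_add \<Rightarrow> 'c) \<Rightarrow>
     'b set \<Rightarrow> 'c set \<Rightarrow> (('b \<times> 'c) \<Rightarrow>\<^sub>0 'k) set" where
  "bilinear_relations s1 s2 V W =
     {gen (v + v') w - gen v w - gen v' w | v v' w. v \<in> V \<and> v' \<in> V \<and> w \<in> W} \<union>
     {gen v (w + w') - gen v w - gen v w' | v w w'. v \<in> V \<and> w \<in> W \<and> w' \<in> W} \<union>
     {gen (s1 c v) w - free_scale c (gen v w) | c v w. v \<in> V \<and> w \<in> W} \<union>
     {gen v (s2 c w) - free_scale c (gen v w) | c v w. v \<in> V \<and> w \<in> W}"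

definition tensor_class ::
    "('k::field \<Rightarrow> 'b::ab_group_add \<Rightarrow> 'b) \<Rightarrow> ('k \<Rightarrow> 'c::ab_group_add \<Rightarrow> 'c) \<Rightarrow>
     'b set \<Rightarrow> 'c set \<Rightarrow> (('b \<times> 'c) \<Rightarrow>\<^sub>0 'k) \<Rightarrow> (('b \<times> 'c) \<Rightarrow>\<^sub>0 'k) set" where
  "tensor_class s1 s2 V W f =
     {g. g - f \<in> module.span free_scale (bilinear_relations s1 s2 V W)}"


section \<open>The composition algebra\<close>

definition dual :: "('k::field \<Rightarrow> 'a::field) \<Rightarrow> ('a \<Rightarrow> 'k) set" where
  "dual \<iota> = {l. Vector_Spaces.linear (scale \<iota>) (*) l}"

definition dual_scale :: "'k::field \<Rightarrow> ('a \<Rightarrow> 'k) \<Rightarrow> ('a \<Rightarrow> 'k)" where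
  "dual_scale c l = (\<lambda>x. c * l x)"

type_synonym ('k, 'a) free_dual = "(('a \<Rightarrow> 'k) \<times> 'a) \<Rightarrow>\<^sub>0 'k"

abbreviation cls ::
    "('k::field \<Rightarrow> 'a::field) \<Rightarrow> ('k, 'a) free_dual \<Rightarrow> ('k, 'a) free_dual set" where
  "cls \<iota> \<equiv> tensor_class dual_scale (scale \<iota>) (dual \<iota>) UNIV"

definition pure_tensor ::
    "('k::field \<Rightarrow> 'a::field) \<Rightarrow> ('a \<Rightarrow> 'k) \<Rightarrow> 'a \<Rightarrow> ('k, 'a) free_dual set" where
  "pure_tensor \<iota> l x = cls \<iota> (gen l x)"

text \<open>
  The bilinear extension to the free space of the product
  \<open>(l1, x1) (l2, x2) = (l1 x2 \<cdot> l2, x1)\<close> of generators. The operations on the tensor product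
  are induced by those on representatives.
\<close>

definition free_mult ::
    "('k::field, 'a) free_dual \<Rightarrow> ('k, 'a) free_dual \<Rightarrow> ('k, 'a) free_dual" where
  "free_mult f g =
     (\<Sum>(l1, x1) \<in> Poly_Mapping.keys f. \<Sum>(l2, x2) \<in> Poly_Mapping.keys g.
        Poly_Mapping.single (dual_scale (l1 x2) l2, x1)
          (Poly_Mapping.lookup f (l1, x1) * Poly_Mapping.lookup g (l2, x2)))"

definition comp_carrier :: "('k::field \<Rightarrow> 'a::field) \<Rightarrow> ('k, 'a) free_dual set set" where
  "comp_carrier \<iota> = cls \<iota> ` free_space (dual \<iota>) UNIV"

definition comp_mult ::
    "('k::field \<Rightarrow> 'a::field) \<Rightarrow> ('k, 'a) free_dual set \<Rightarrow> ('k, 'a) free_dual set \<Rightarrow>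
     ('k, 'a) free_dual set" where
  "comp_mult \<iota> A B = (\<Union>f\<in>A. \<Union>g\<in>B. cls \<iota> (free_mult f g))"

definition composition_algebra ::
    "('k::field \<Rightarrow> 'a::field) \<Rightarrow> ('k, ('k, 'a) free_dual set) module" where
  "composition_algebra \<iota> = \<lparr>
     carrier = comp_carrier \<iota>,
     mult = comp_mult \<iota>,
     one = (THE e. e \<in> comp_carrier \<iota> \<and>
       (\<forall>A\<in>comp_carrier \<iota>. comp_mult \<iota> e A = A \<and> comp_mult \<iota> A e = A)),
     zero = cls \<iota> 0,
     add = (\<lambda>A B. \<Union>f\<in>A. \<Union>g\<in>B. cls \<iota> (f + g)),
     smult = (\<lambda>c A. \<Union>f\<in>A. cls \<iota> (free_scale c f)) \<rparr>"

definition trace_form ::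
    "('k::{field,finite} \<Rightarrow> 'a::field) \<Rightarrow> nat \<Rightarrow> 'a \<Rightarrow> ('a \<Rightarrow> 'k)" where
  "trace_form \<iota> n \<alpha> = (\<lambda>x. trace \<iota> n (\<alpha> * x))"

definition V_set ::
    "('k::{field,finite} \<Rightarrow> 'a::{field,finite}) \<Rightarrow> nat \<Rightarrow> nat \<Rightarrow> 'a \<Rightarrow>
     ('k, 'a) free_dual set set" where
  "V_set \<iota> m t \<beta> =
     {(\<Oplus>\<^bsub>composition_algebra \<iota>\<^esub> i\<in>{..<m * t}.
         pure_tensor \<iota> (trace_form \<iota> (m * t) (\<beta> ^ (CARD('k) ^ i))) (\<alpha> i)) | \<alpha>.
      \<forall>j<t. \<forall>k<m. \<alpha> (j * m + k) = \<alpha> k ^ (CARD('k) ^ (j * m))}"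

section \<open>The induced product is well defined\<close>

text \<open>
  The lemmas \<open>comp_mult_cls\<close> and \<open>comp_mult_pure\<close> confirm that \<open>comp_mult\<close> does not depend on
  the representatives and is given by the composition rule on pure tensors.
\<close>

lemma lookup_free_scale [simp]: "Poly_Mapping.lookup (free_scale c f) x = c * Poly_Mapping.lookup f x"
  by (simp add: free_scale_def Poly_Mapping.map.rep_eq when_def)

lemma vector_space_free_scale: "vector_space (free_scale :: 'k::field \<Rightarrow> ('x \<Rightarrow>\<^sub>0 'k) \<Rightarrow> _)"
  by unfold_locales (auto intro!: poly_mapping_eqI simp: lookup_add algebra_simps)

lemma free_scale_single [simp]: "free_scale c (Poly_Mapping.single x a) = Poly_Mapping.single x (c * a)"
  by (rule poly_mapping_eqI) (simp add: lookup_single when_def)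

lemma vector_space_scale: "field_embedding \<iota> \<Longrightarrow> vector_space (scale \<iota>)"
  by unfold_locales (auto simp: field_embedding_def scale_def algebra_simps)

lemma dual_iff:
  assumes "field_embedding \<iota>"
  shows "l \<in> dual \<iota> \<longleftrightarrow> (\<forall>x y. l (x + y) = l x + l y) \<and> (\<forall>c x. l (scale \<iota> c x) = c * l x)"
proof -
  have "vector_space (scale \<iota>)" by (rule vector_space_scale[OF assms])
  moreover have "vector_space ((*) :: 'a \<Rightarrow> 'a \<Rightarrow> 'a)" by unfold_locales (auto simp: algebra_simps)
  ultimately show ?thesis
    unfolding dual_def mem_Collect_eq Vector_Spaces.linear_iff by auto
qed

definition term_mult :: "(('a \<Rightarrow> 'k) \<times> 'a) \<Rightarrow> 'k::field \<Rightarrow> (('a \<Rightarrow> 'k) \<times> 'a) \<Rightarrow> 'k \<Rightarrow> ('k, 'a) free_dual" where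
  "term_mult p a r b = Poly_Mapping.single (dual_scale (fst p (snd r)) (fst r), snd p) (a * b)"

lemma term_mult_0 [simp]: "term_mult p 0 r b = 0" "term_mult p a r 0 = 0"
  by (simp_all add: term_mult_def)

lemma free_mult_superset:
  assumes "finite S" "finite T" "Poly_Mapping.keys f \<subseteq> S" "Poly_Mapping.keys g \<subseteq> T"
  shows "free_mult f g = (\<Sum>p\<in>S. \<Sum>r\<in>T. term_mult p (Poly_Mapping.lookup f p) r (Poly_Mapping.lookup g r))"
proof -
  have "free_mult f g = (\<Sum>p\<in>Poly_Mapping.keys f. \<Sum>r\<in>Poly_Mapping.keys g. term_mult p (Poly_Mapping.lookup f p) r (Poly_Mapping.lookup g r))"
    unfolding free_mult_def term_mult_def by (intro sum.cong refl) (auto simp: case_prod_beta)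
  also have "\<dots> = (\<Sum>p\<in>Poly_Mapping.keys f. \<Sum>r\<in>T. term_mult p (Poly_Mapping.lookup f p) r (Poly_Mapping.lookup g r))"
    by (intro sum.cong refl sum.mono_neutral_left) (use assms in \<open>auto simp: in_keys_iff\<close>)
  also have "\<dots> = (\<Sum>p\<in>S. \<Sum>r\<in>T. term_mult p (Poly_Mapping.lookup f p) r (Poly_Mapping.lookup g r))"
    by (intro sum.mono_neutral_left) (use assms in \<open>auto simp: in_keys_iff\<close>)
  finally show ?thesis .
qed

lemma free_mult_add_left: "free_mult (f + f') g = free_mult f g + free_mult f' g"
proof -
  let ?S = "Poly_Mapping.keys f \<union> Poly_Mapping.keys f'"
  have k: "Poly_Mapping.keys (f + f') \<subseteq> ?S" by (rule Poly_Mapping.keys_add)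
  show ?thesis
    using k by (subst (1 2 3) free_mult_superset[of ?S "Poly_Mapping.keys g"])
      (auto simp: term_mult_def lookup_add single_add algebra_simps sum.distrib)
qed

lemma free_mult_add_right: "free_mult f (g + g') = free_mult f g + free_mult f g'"
proof -
  let ?T = "Poly_Mapping.keys g \<union> Poly_Mapping.keys g'"
  have k: "Poly_Mapping.keys (g + g') \<subseteq> ?T" by (rule Poly_Mapping.keys_add)
  show ?thesis
    using k by (subst (1 2 3) free_mult_superset[of "Poly_Mapping.keys f" ?T])
      (auto simp: term_mult_def lookup_add single_add algebra_simps sum.distrib)
qed

lemma free_mult_scale_left:
  fixes f g :: "('a::field, 'b) free_dual"
  shows "free_mult (free_scale c f) g = free_scale c (free_mult f g)"
proof -
  interpret vector_space "free_scale :: 'a \<Rightarrow> (('b \<Rightarrow> 'a) \<times> 'b \<Rightarrow>\<^sub>0 'a) \<Rightarrow> _" by (rule vector_space_free_scale)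
  have k: "Poly_Mapping.keys (free_scale c f) \<subseteq> Poly_Mapping.keys f" by (auto simp: in_keys_iff)
  show ?thesis
    using k by (subst (1 2) free_mult_superset[of "Poly_Mapping.keys f" "Poly_Mapping.keys g"])
      (auto simp: term_mult_def scale_sum_right algebra_simps)
qed

lemma free_mult_scale_right:
  fixes f g :: "('a::field, 'b) free_dual"
  shows "free_mult f (free_scale c g) = free_scale c (free_mult f g)"
proof -
  interpret vector_space "free_scale :: 'a \<Rightarrow> (('b \<Rightarrow> 'a) \<times> 'b \<Rightarrow>\<^sub>0 'a) \<Rightarrow> _" by (rule vector_space_free_scale)
  have k: "Poly_Mapping.keys (free_scale c g) \<subseteq> Poly_Mapping.keys g" by (auto simp: in_keys_iff)
  show ?thesis
    using k by (subst (1 2) free_mult_superset[of "Poly_Mapping.keys f" "Poly_Mapping.keys g"])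
      (auto simp: term_mult_def scale_sum_right algebra_simps)
qed

lemma free_mult_gen: "free_mult (gen l1 x1) (gen l2 x2) = gen (dual_scale (l1 x2) l2) x1"
  by (simp add: free_mult_def)

lemma free_mult_minus_left: "free_mult (f - f') g = free_mult f g - free_mult f' g"
  by (metis add_diff_cancel_right' diff_add_cancel free_mult_add_left)

lemma free_mult_minus_right: "free_mult f (g - g') = free_mult f g - free_mult f g'"
  by (metis add_diff_cancel_right' diff_add_cancel free_mult_add_right)

abbreviation "null_space \<iota> \<equiv> module.span free_scale (bilinear_relations dual_scale (scale \<iota>) (dual \<iota>) UNIV)"

lemma free_space_induct [consumes 1, case_names zero add scale gen]:
  assumes "f \<in> free_space V W" "P 0" "\<And>f g. P f \<Longrightarrow> P g \<Longrightarrow> P (f + g)"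
    "\<And>c f. P f \<Longrightarrow> P (free_scale c f)" "\<And>v w. v \<in> V \<Longrightarrow> w \<in> W \<Longrightarrow> P (gen v w)"
  shows "P f"
proof -
  have s: "P (\<Sum>x\<in>S. h x)" if "\<And>x. x \<in> S \<Longrightarrow> P (h x)" for h and S :: "('a \<times> 'b) set"
    using that by (induction S rule: infinite_finite_induct) (auto intro: assms)
  have "f = (\<Sum>x\<in>Poly_Mapping.keys f. Poly_Mapping.single x (Poly_Mapping.lookup f x))"
    by (rule poly_mapping_eqI) (auto simp: lookup_sum lookup_single when_def in_keys_iff sum.delta)
  also have "P \<dots>"
  proof (rule s)
    fix x assume "x \<in> Poly_Mapping.keys f"
    then have "fst x \<in> V" "snd x \<in> W" using assms(1) by (auto simp: free_space_def)
    from assms(4)[OF assms(5)[OF this], of "Poly_Mapping.lookup f x"]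
    show "P (Poly_Mapping.single x (Poly_Mapping.lookup f x))" by simp
  qed
  finally show ?thesis .
qed

lemma null_mult:
  assumes emb: "field_embedding \<iota>" and f: "f \<in> free_space (dual \<iota>) UNIV"
  shows "z \<in> null_space \<iota> \<Longrightarrow> free_mult z f \<in> null_space \<iota>"
    and "z \<in> null_space \<iota> \<Longrightarrow> free_mult f z \<in> null_space \<iota>"
proof -
  interpret V: vector_space "free_scale :: 'a \<Rightarrow> (('b \<Rightarrow> 'a) \<times> 'b \<Rightarrow>\<^sub>0 'a) \<Rightarrow> _" by (rule vector_space_free_scale)
  let ?R = "bilinear_relations dual_scale (scale \<iota>) (dual \<iota>) UNIV"
  note lin = dual_iff[OF emb]
  have r1: "gen (v + v') w - gen v w - gen v' w \<in> null_space \<iota>" if "v \<in> dual \<iota>" "v' \<in> dual \<iota>" for v v' w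
    by (rule V.span_base) (use that in \<open>force simp: bilinear_relations_def\<close>)
  have r2: "gen v (w + w') - gen v w - gen v w' \<in> null_space \<iota>" if "v \<in> dual \<iota>" for v w w'
    by (rule V.span_base) (use that in \<open>force simp: bilinear_relations_def\<close>)
  have r3: "gen (dual_scale c v) w - free_scale c (gen v w) \<in> null_space \<iota>" if "v \<in> dual \<iota>" for c v w
    by (rule V.span_base) (use that in \<open>unfold bilinear_relations_def, blast\<close>)
  have r4: "gen v (scale \<iota> c w) - free_scale c (gen v w) \<in> null_space \<iota>" if "v \<in> dual \<iota>" for c v w
    by (rule V.span_base) (use that in \<open>unfold bilinear_relations_def, blast\<close>)
  have ds: "dual_scale c v \<in> dual \<iota>" if "v \<in> dual \<iota>" for c v
    using that by (auto simp: lin dual_scale_def algebra_simps)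
  have dd: "dual_scale (a + b) l = dual_scale a l + dual_scale b l"
           "dual_scale a (l + l') = dual_scale a l + dual_scale a l'"
           "dual_scale (a * b) l = dual_scale a (dual_scale b l)" 
           "dual_scale a (dual_scale b l) = dual_scale b (dual_scale a l)" for a b :: 'a and l l' :: "'b \<Rightarrow> 'a"
    by (auto simp: dual_scale_def plus_fun_def algebra_simps)
  have R1: "free_mult z (gen l x) \<in> null_space \<iota>" if z: "z \<in> ?R" and l: "l \<in> dual \<iota>" for z l x
  proof -
    consider (a) v v' w where "z = gen (v + v') w - gen v w - gen v' w" "v \<in> dual \<iota>" "v' \<in> dual \<iota>"
      | (b) v w w' where "z = gen v (w + w') - gen v w - gen v w'" "v \<in> dual \<iota>"
      | (c) c v w where "z = gen (dual_scale c v) w - free_scale c (gen v w)" "v \<in> dual \<iota>"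
      | (d) c v w where "z = gen v (scale \<iota> c w) - free_scale c (gen v w)" "v \<in> dual \<iota>"
      using z unfolding bilinear_relations_def by blast
    then show ?thesis
    proof cases
      case a
      have "dual_scale ((v + v') x) l = dual_scale (v x) l + dual_scale (v' x) l" using dd(1) by (simp add: plus_fun_def)
      then show ?thesis unfolding a free_mult_minus_left free_mult_gen using r1[OF ds[OF l] ds[OF l]] by simp
    next
      case b
      show ?thesis unfolding b free_mult_minus_left free_mult_gen by (rule r2[OF ds[OF l]])
    next
      case c
      have "dual_scale (dual_scale c v x) l = dual_scale c (dual_scale (v x) l)" by (simp add: dual_scale_def mult.assoc)
      then show ?thesis unfolding c free_mult_minus_left free_mult_scale_left free_mult_gen using r3[OF ds[OF l]] by presburger
    next
      case d
      show ?thesis unfolding d free_mult_minus_left free_mult_scale_left free_mult_gen by (rule r4[OF ds[OF l]])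
    qed
  qed
  have R2: "free_mult (gen l x) z \<in> null_space \<iota>" if z: "z \<in> ?R" and l: "l \<in> dual \<iota>" for z l x
  proof -
    consider (a) v v' w where "z = gen (v + v') w - gen v w - gen v' w" "v \<in> dual \<iota>" "v' \<in> dual \<iota>"
      | (b) v w w' where "z = gen v (w + w') - gen v w - gen v w'" "v \<in> dual \<iota>"
      | (c) c v w where "z = gen (dual_scale c v) w - free_scale c (gen v w)" "v \<in> dual \<iota>"
      | (d) c v w where "z = gen v (scale \<iota> c w) - free_scale c (gen v w)" "v \<in> dual \<iota>"
      using z unfolding bilinear_relations_def by blast
    then show ?thesis
    proof cases
      case a
      show ?thesis unfolding a free_mult_minus_right free_mult_gen dd(2) by (intro r1 ds a)
    next
      case b
      have "l (w + w') = l w + l w'" using l by (simp add: lin)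
      then show ?thesis unfolding b free_mult_minus_right free_mult_gen using r1[OF ds ds] b(2) dd(1) by presburger
    next
      case c
      have "dual_scale (l w) (dual_scale c v) = dual_scale c (dual_scale (l w) v)" by (rule dd(4))
      then show ?thesis unfolding c free_mult_minus_right free_mult_scale_right free_mult_gen using r3[OF ds[OF c(2)]] by presburger
    next
      case d
      have "l (scale \<iota> c w) = c * l w" using l by (simp add: lin)
      then have "dual_scale (l (scale \<iota> c w)) v = dual_scale c (dual_scale (l w) v)" using dd(3) by presburger
      then show ?thesis unfolding d free_mult_minus_right free_mult_scale_right free_mult_gen using r3[OF ds[OF d(2)]] by presburger
    qed
  qed
  have R1': "free_mult z f \<in> null_space \<iota>" if z: "z \<in> ?R" for z
    using f by (induction rule: free_space_induct)
      (auto simp: free_mult_add_right free_mult_scale_right R1[OF z] simp: V.span_add V.span_scale V.span_zero free_mult_def[of _ 0])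
  have R2': "free_mult f z \<in> null_space \<iota>" if z: "z \<in> ?R" for z
    using f by (induction rule: free_space_induct)
      (auto simp: free_mult_add_left free_mult_scale_left R2[OF z] simp: V.span_add V.span_scale V.span_zero free_mult_def[of 0])
  show "free_mult z f \<in> null_space \<iota>" if "z \<in> null_space \<iota>"
    using that by (induction rule: V.span_induct_alt)
      (auto simp: free_mult_add_left free_mult_scale_left R1' V.span_add V.span_scale V.span_zero free_mult_def[of 0])
  show "free_mult f z \<in> null_space \<iota>" if "z \<in> null_space \<iota>"
    using that by (induction rule: V.span_induct_alt)
      (auto simp: free_mult_add_right free_mult_scale_right R2' V.span_add V.span_scale V.span_zero free_mult_def[of _ 0])
qed

lemma null_space_subset:
  assumes emb: "field_embedding \<iota>"
  shows "null_space \<iota> \<subseteq> free_space (dual \<iota>) UNIV"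
proof
  interpret V: vector_space "free_scale :: 'a \<Rightarrow> (('b \<Rightarrow> 'a) \<times> 'b \<Rightarrow>\<^sub>0 'a) \<Rightarrow> _" by (rule vector_space_free_scale)
  note lin = dual_iff[OF emb]
  have sub: "V.subspace (free_space (dual \<iota>) UNIV)"
    unfolding V.subspace_def free_space_def
    by (auto simp: in_keys_iff subset_iff lookup_add) (metis add.left_neutral)+
  have g: "gen l x \<in> free_space (dual \<iota>) UNIV" if "l \<in> dual \<iota>" for l x
    using that by (simp add: free_space_def)
  have d: "v + v' \<in> dual \<iota>" "dual_scale c v \<in> dual \<iota>" if "v \<in> dual \<iota>" "v' \<in> dual \<iota>" for v v' c
    using that by (auto simp: lin dual_scale_def plus_fun_def algebra_simps)
  have "bilinear_relations dual_scale (scale \<iota>) (dual \<iota>) UNIV \<subseteq> free_space (dual \<iota>) UNIV"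
    unfolding bilinear_relations_def
    by (intro Un_least subsetI; elim CollectE exE conjE; hypsubst)
      (intro V.subspace_diff[OF sub] V.subspace_scale[OF sub] g d; assumption)+
  then show "x \<in> free_space (dual \<iota>) UNIV" if "x \<in> null_space \<iota>" for x
    using V.span_minimal[OF _ sub] that by blast
qed

lemma comp_mult_cls:
  assumes emb: "field_embedding \<iota>"
    and f: "f \<in> free_space (dual \<iota>) UNIV" and g: "g \<in> free_space (dual \<iota>) UNIV"
  shows "comp_mult \<iota> (cls \<iota> f) (cls \<iota> g) = cls \<iota> (free_mult f g)"
proof -
  interpret V: vector_space "free_scale :: 'a \<Rightarrow> (('b \<Rightarrow> 'a) \<times> 'b \<Rightarrow>\<^sub>0 'a) \<Rightarrow> _" by (rule vector_space_free_scale)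
  have eq: "cls \<iota> u = cls \<iota> v" if "u - v \<in> null_space \<iota>" for u v
  proof -
    have "h - u \<in> null_space \<iota> \<longleftrightarrow> h - v \<in> null_space \<iota>" for h
      using V.span_add[OF _ that, of "h - u"] V.span_diff[OF _ that, of "h - v"] by auto
    then show ?thesis by (simp add: tensor_class_def)
  qed
  have "cls \<iota> (free_mult f' g') = cls \<iota> (free_mult f g)" if "f' \<in> cls \<iota> f" "g' \<in> cls \<iota> g" for f' g'
  proof (rule eq)
    have 1: "f' - f \<in> null_space \<iota>" "g' - g \<in> null_space \<iota>" using that by (auto simp: tensor_class_def)
    then have "free_mult (f' - f) (g' - g) \<in> null_space \<iota>"
      using null_mult(1)[OF emb] null_space_subset[OF emb] by blast
    moreover have "free_mult f' g' - free_mult f g = free_mult (f' - f) (g' - g) + free_mult (f' - f) g + free_mult f (g' - g)"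
      by (simp add: free_mult_minus_left free_mult_minus_right)
    ultimately show "free_mult f' g' - free_mult f g \<in> null_space \<iota>"
      using null_mult[OF emb g] null_mult[OF emb f] 1 by (simp add: V.span_add)
  qed
  moreover have "f \<in> cls \<iota> f" "g \<in> cls \<iota> g" by (simp_all add: tensor_class_def V.span_zero)
  ultimately show ?thesis unfolding comp_mult_def by blast
qed

lemma comp_mult_pure:
  assumes "field_embedding \<iota>" "l1 \<in> dual \<iota>" "l2 \<in> dual \<iota>"
  shows "comp_mult \<iota> (pure_tensor \<iota> l1 x1) (pure_tensor \<iota> l2 x2)
    = pure_tensor \<iota> (dual_scale (l1 x2) l2) x1"
  unfolding pure_tensor_def using assms
  by (subst comp_mult_cls) (auto simp: free_space_def free_mult_gen)

end

theory Submission
  imports Defs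
begin

text \<open>
  Both algebras are copies of a subalgebra of \<open>End(F)\<close>, the algebra of base-field-linear maps of
  the extension \<open>F\<close>: the maps that commute with the Frobenius power \<open>x \<mapsto> x\<^bsup>q^m\<^esup>\<close>
  (\<open>frobenius_endos\<close>).

  The trace form is nondegenerate, so the normal basis \<open>\<beta>\<^bsup>q^i\<^esup>\<close> has a dual basis, and this is
  again normal, \<open>\<gamma> j = (\<gamma> 0)\<^bsup>q^j\<^esup>\<close>, because the trace is invariant under Frobenius (\<open>\<tau>_\<gamma>\<close>).
  Consequently every linear map has the expansion
  \<open>g(x) = \<Sum>j. tr(\<beta>\<^bsup>q^j\<^esup> x) g(\<gamma> j)\<close> (\<open>endo_expansion\<close>), which can be read in two ways.

  Writing out the traces, it is a linearized polynomial, unique because its degree is below the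
  number of elements of \<open>F\<close>. Composition of maps is composition of polynomials modulo
  \<open>X\<^bsup>q^n\<^esup> - X\<close> (\<open>interp_iso\<close>). Comparing coefficients of a map and of its conjugate, the
  coefficients lie in the field with \<open>q\<^bsup>m\<^esup>\<close> elements exactly if the map commutes with
  \<open>x \<mapsto> x\<^bsup>q^m\<^esup>\<close> (\<open>lin_poly_commutes_iff\<close>).

  Read as a tensor, it is \<open>\<Sum>j. T\<^sub>j \<otimes> g(\<gamma> j)\<close>, where \<open>l \<otimes> x\<close> stands for the map \<open>y \<mapsto> l(y) x\<close>.
  Every tensor can be brought to this form by bilinearity (\<open>tensor_normal_form\<close>), so tensors and
  linear maps correspond bijectively, and the product of the composition algebra is composition of
  maps (\<open>fiber_iso\<close>). As the \<open>\<gamma> j\<close> are conjugates, commuting with \<open>x \<mapsto> x\<^bsup>q^m\<^esup>\<close> says that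
  \<open>\<alpha>\<^sub>j = g(\<gamma> j)\<close> satisfies \<open>\<alpha>\<^bsub>jm+k\<^esub> = \<alpha>\<^sub>k\<^bsup>q^(jm)\<^esup>\<close>, which is the definition of
  \<open>V\<^sub>m\<close> (\<open>expand_commutes_iff\<close>).
\<close>

section \<open>Frobenius powers and the trace\<close>

text \<open>
  Multiplication by a nonzero \<open>x\<close> permutes the nonzero elements; comparing their product before and
  after gives Fermat's little theorem.
\<close>
lemma power_CARD_eq_self:
  fixes x :: "'a::{field,finite}"
  shows "x ^ CARD('a) = x"
proof (cases "x = 0")
  case False
  let ?U = "UNIV - {0 :: 'a}"
  have "bij_betw ((*) x) ?U ?U"
    by (rule bij_betw_byWitness[where f' = "\<lambda>y. y / x"]) (use False in auto)
  then have "(\<Prod>y\<in>?U. x * y) = \<Prod>?U"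
    by (rule prod.reindex_bij_betw)
  then have "x ^ (CARD('a) - 1) = 1"
    by (simp add: prod.distrib card_Diff_singleton)
  then have "x ^ Suc (CARD('a) - 1) = x" by (simp only: power_Suc mult_1_right)
  moreover have "Suc (CARD('a) - 1) = CARD('a)" by (simp add: card_gt_0_iff)
  ultimately show ?thesis by metis
qed simp

locale normal_basis_extension =
  fixes \<iota> :: "'k::{field,finite} \<Rightarrow> 'a::{field,finite}" and q n :: nat and \<beta> :: 'a
  assumes q_primepow: "primepow q" and n_pos: "n > 0"
    and card_base: "CARD('k) = q" and card_ext: "CARD('a) = q ^ n"
    and embedding: "field_embedding \<iota>"
    and normal: "normal_basis_generator \<iota> n \<beta>"
begin

lemma q_gt_1: "q > 1"
  using primepow_gt_Suc_0[OF q_primepow] by simp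

lemma embedding_simps [simp]:
  "\<iota> 1 = 1" "\<iota> (c + d) = \<iota> c + \<iota> d" "\<iota> (c * d) = \<iota> c * \<iota> d" "\<iota> 0 = 0"
proof -
  show add: "\<iota> (c + d) = \<iota> c + \<iota> d" for c d
    using embedding by (simp add: field_embedding_def)
  show "\<iota> 1 = 1" "\<iota> (c * d) = \<iota> c * \<iota> d"
    using embedding by (simp_all add: field_embedding_def)
  have "\<iota> 0 + 0 = \<iota> 0 + \<iota> 0" using add[of 0 0] by simp
  then show "\<iota> 0 = 0" by (simp only: add_left_cancel)
qed

lemma embedding_power: "\<iota> (c ^ i) = \<iota> c ^ i"
  by (induction i) auto

lemma embedding_eq_0_iff [simp]: "\<iota> c = 0 \<longleftrightarrow> c = 0"
proof
  assume "\<iota> c = 0"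
  then have "\<iota> (c * inverse c) = 0" by (simp del: right_inverse)
  then show "c = 0" by (cases "c = 0") auto
qed simp

lemma embedding_eq_iff [simp]: "\<iota> c = \<iota> d \<longleftrightarrow> c = d"
proof
  assume "\<iota> c = \<iota> d"
  moreover have "\<iota> c = \<iota> (c - d) + \<iota> d" by (simp flip: embedding_simps(2))
  ultimately have "\<iota> (c - d) = 0" by simp
  then show "c = d" by simp
qed simp

sublocale vector_space "scale \<iota>"
  by (rule vector_space_scale[OF embedding])

lemma q_power_of_CHAR: "\<exists>e. q = CHAR('a) ^ e"
proof -
  obtain p e where pe: "prime p" "q = p ^ e" using q_primepow unfolding primepow_def by blast
  have "prime CHAR('a)" by (intro prime_CHAR_semidom finite_imp_CHAR_pos) simp
  moreover have "CHAR('a) dvd p ^ (e * n)"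
  proof -
    \<comment> \<open>Translating all elements by 1 permutes them, so their sum absorbs \<open>CARD('a)\<close> ones.\<close>
    have "(\<Sum>y\<in>UNIV. y + 1 :: 'a) = \<Sum>UNIV"
      by (rule sum.reindex_bij_witness[of _ "\<lambda>y. y - 1" "\<lambda>y. y + 1"]) auto
    then have "of_nat CARD('a) = (0 :: 'a)" by (simp add: sum.distrib)
    then show ?thesis by (simp add: of_nat_eq_0_iff_char_dvd card_ext pe(2) power_mult del: of_nat_power)
  qed
  ultimately have "CHAR('a) = p" using pe(1) prime_dvd_power primes_dvd_imp_eq by blast
  then show ?thesis using pe(2) by blast
qed

lemma frobenius_sum: "(\<Sum>i\<in>S. f i :: 'a) ^ (q ^ j) = (\<Sum>i\<in>S. f i ^ (q ^ j))"
proof -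
  obtain e where "q = CHAR('a) ^ e" using q_power_of_CHAR by blast
  then have "q ^ j = CHAR('a) ^ (e * j)" by (simp add: power_mult)
  then show ?thesis
    by (intro freshmans_dream_sum' prime_CHAR_semidom finite_imp_CHAR_pos) auto
qed

lemma frobenius_add: "(x + y :: 'a) ^ (q ^ j) = x ^ (q ^ j) + y ^ (q ^ j)"
  using frobenius_sum[of "\<lambda>b. if b then x else y" UNIV j] by (simp add: UNIV_bool add.commute)

lemma frobenius_frobenius: "((x :: 'a) ^ (q ^ i)) ^ (q ^ j) = x ^ (q ^ (i + j))"
  by (simp add: power_mult[symmetric] power_add)

lemma frobenius_base [simp]: "\<iota> c ^ (q ^ j) = \<iota> c"
proof (induction j)
  case (Suc j)
  have "\<iota> c ^ (q ^ Suc j) = (\<iota> (c ^ q)) ^ (q ^ j)"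
    by (simp add: embedding_power power_mult[symmetric])
  then show ?case using Suc power_CARD_eq_self[of c] by (simp add: card_base)
qed simp

lemma frobenius_n: "(x :: 'a) ^ (q ^ (n + i)) = x ^ (q ^ i)"
  using power_CARD_eq_self[of x] by (simp add: card_ext power_add power_mult)

lemma frobenius_n_mult: "(x :: 'a) ^ (q ^ (n * i)) = x"
  by (induction i) (simp_all add: frobenius_n)

lemma surj_frobenius: "\<exists>y :: 'a. y ^ (q ^ j) = x"
proof
  have "j \<le> n * j" using n_pos by simp
  then show "(x ^ (q ^ (n * j - j))) ^ (q ^ j) = x"
    by (simp add: frobenius_frobenius frobenius_n_mult)
qed

text \<open>
  The image of the base field consists of \<open>q\<close> roots of \<open>X\<^bsup>q\<^esup> - X\<close>, so by its degree this
  polynomial has no others.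
\<close>
lemma fixed_imp_base:
  assumes "(x :: 'a) ^ q = x"
  shows "\<exists>c. \<iota> c = x"
proof -
  let ?p = "Polynomial.monom 1 q - Polynomial.monom 1 1 :: 'a poly"
  have "Polynomial.coeff ?p q = 1" using q_gt_1 by simp
  then have p: "?p \<noteq> 0" by (metis Polynomial.coeff_0 zero_neq_one)
  have "degree ?p \<le> q"
    using q_gt_1 by (intro degree_diff_le) (auto simp: degree_monom_eq)
  then have le: "card {x. poly ?p x = 0} \<le> q" using card_poly_roots_bound[OF p] by linarith
  have sub: "range \<iota> \<subseteq> {x. poly ?p x = 0}"
    using frobenius_base[where j = 1] by (auto simp: poly_monom)
  have card: "card (range \<iota>) = q" by (simp add: card_image inj_on_def card_base)
  then have "range \<iota> = {x. poly ?p x = 0}"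
    by (intro card_seteq[OF _ sub]) (use le card in simp_all)
  then have "x \<in> range \<iota>" using assms by (simp add: poly_monom)
  then show ?thesis by (metis rangeE)
qed

abbreviation tr :: "'a \<Rightarrow> 'k" where "tr \<equiv> trace \<iota> n"

lemma embedding_trace: "\<iota> (tr x) = (\<Sum>i<n. x ^ (q ^ i))"
proof -
  let ?s = "\<Sum>i<n. x ^ (q ^ i)"
  have "?s ^ q = ?s"
  proof -
    have "?s ^ (q ^ 1) = (\<Sum>i<n. x ^ (q ^ Suc i))"
      by (subst frobenius_sum) (simp only: frobenius_frobenius Suc_eq_plus1)
    also have "\<dots> = (\<Sum>i\<in>{..<n} - {0}. x ^ (q ^ i)) + x ^ (q ^ n)"
    proof -
      obtain n' where n': "n = Suc n'" using n_pos by (cases n) auto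
      have "{..<n} - {0} = Suc ` {..<n'}" by (auto simp: n' image_iff less_Suc_eq_0_disj)
      then show ?thesis by (simp add: n' sum.reindex del: power_Suc)
    qed
    also have "x ^ (q ^ n) = x ^ (q ^ 0)" using frobenius_n[of x 0] by simp
    also have "(\<Sum>i\<in>{..<n} - {0}. x ^ (q ^ i)) + x ^ (q ^ 0) = ?s"
      using n_pos by (subst (2) sum.remove[of _ 0]) auto
    finally show ?thesis by simp
  qed
  then obtain c where c: "\<iota> c = ?s" using fixed_imp_base by blast
  have "tr x = c" unfolding trace_def card_base c[symmetric] by simp
  then show ?thesis using c by simp
qed

lemma trace_add: "tr (x + y) = tr x + tr y"
  by (subst embedding_eq_iff[symmetric]) (simp add: embedding_trace frobenius_add sum.distrib)

lemma trace_scale: "tr (\<iota> c * x) = c * tr x"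
  by (subst embedding_eq_iff[symmetric])
    (simp add: embedding_trace power_mult_distrib sum_distrib_left)

lemma trace_0 [simp]: "tr 0 = 0"
  using trace_scale[of 0 0] by simp

lemma trace_frobenius: "tr (x ^ (q ^ j)) = tr x"
proof (subst embedding_eq_iff[symmetric])
  have "\<iota> (tr (x ^ (q ^ j))) = \<iota> (tr x) ^ (q ^ j)"
    by (simp only: embedding_trace frobenius_sum frobenius_frobenius add.commute)
  then show "\<iota> (tr (x ^ (q ^ j))) = \<iota> (tr x)" by simp
qed

text \<open>
  The trace is a nonzero polynomial function of degree \<open>q\<^bsup>n-1\<^esup>\<close>, smaller than the number of
  elements of the extension, so it takes a nonzero value; hence the form \<open>tr (x * y)\<close> is
  nondegenerate.
\<close>
lemma trace_form_nondegenerate: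
  assumes "\<And>x. tr (x * y) = 0"
  shows "y = 0"
proof (rule ccontr)
  assume "y \<noteq> 0"
  then have tr0: "tr x = 0" for x using assms[of "x / y"] by simp
  let ?p = "\<Sum>i<n. Polynomial.monom 1 (q ^ i) :: 'a poly"
  have "?p = 0"
  proof (rule poly_eqI_degree[of UNIV])
    show "poly ?p x = poly 0 x" for x
      using embedding_trace[of x] tr0[of x] by (simp add: poly_sum poly_monom)
    have "degree ?p \<le> q ^ (n - 1)"
      using q_gt_1 by (intro degree_sum_le) (auto simp: degree_monom_eq intro!: power_increasing)
    also have "\<dots> < q ^ n" using q_gt_1 n_pos by (intro power_strict_increasing) auto
    finally show "degree ?p < CARD('a)" by (simp add: card_ext)
  qed (use finite_UNIV_card_ge_0 in auto)
  moreover have "Polynomial.coeff ?p 1 = 1"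
  proof -
    have "Polynomial.coeff ?p 1 = (\<Sum>i<n. if i = 0 then 1 else 0)"
      unfolding Polynomial.coeff_sum using q_gt_1 by (intro sum.cong) auto
    then show ?thesis using n_pos by simp
  qed
  ultimately show False by simp
qed

section \<open>The dual normal basis\<close>

text \<open>The functionals \<open>T\<^sub>i(x) = tr(\<beta>\<^bsup>q^i\<^esup> x)\<close> attached to the normal basis.\<close>
definition \<tau> :: "nat \<Rightarrow> 'a \<Rightarrow> 'k" where
  "\<tau> i = trace_form \<iota> n (\<beta> ^ (q ^ i))"

lemma \<tau>_eq: "\<tau> i x = tr (\<beta> ^ (q ^ i) * x)"
  by (simp add: \<tau>_def trace_form_def)

lemma \<tau>_add: "\<tau> i (x + y) = \<tau> i x + \<tau> i y"
  by (simp add: \<tau>_eq distrib_left trace_add)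

lemma \<tau>_scale: "\<tau> i (\<iota> c * x) = c * \<tau> i x"
  using trace_scale[of c "\<beta> ^ (q ^ i) * x"] by (simp add: \<tau>_eq algebra_simps)

lemma \<tau>_0 [simp]: "\<tau> i 0 = 0"
  by (simp add: \<tau>_eq)

lemma \<tau>_diff: "\<tau> i (x - y) = \<tau> i x - \<tau> i y"
  using \<tau>_add[of i "x - y" y] by simp

lemma \<tau>_sum: "\<tau> i (\<Sum>j\<in>S. f j) = (\<Sum>j\<in>S. \<tau> i (f j))"
  by (induction S rule: infinite_finite_induct) (auto simp: \<tau>_add)

lemma \<tau>_in_dual: "\<tau> i \<in> dual \<iota>"
  by (simp add: dual_iff[OF embedding] \<tau>_add \<tau>_scale scale_def)

text \<open>
  The conjugates of \<open>\<beta>\<close> span, so vanishing of all \<open>\<tau> i\<close> on an element puts it in the radical of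
  the trace form.
\<close>
lemma \<tau>_eqI:
  assumes "\<And>i. i < n \<Longrightarrow> \<tau> i x = \<tau> i y"
  shows "x = y"
proof -
  have "tr (b * (x - y)) = 0" for b
  proof -
    have "b \<in> span ((\<lambda>i. \<beta> ^ (q ^ i)) ` {..<n})"
      using normal by (simp add: normal_basis_generator_def card_base)
    then show ?thesis
    proof (induction rule: span_induct_alt)
      case (step c b b')
      then obtain i where i: "i < n" "b = \<beta> ^ (q ^ i)" by auto
      have "tr (b * (x - y)) = 0"
        using assms[OF i(1)] \<tau>_diff[of i x y] by (simp add: i(2) \<tau>_eq)
      then have "tr (\<iota> c * (b * (x - y)) + b' * (x - y)) = 0"
        by (simp add: trace_add trace_scale step.IH)
      then show ?case by (simp add: scale_def distrib_right mult.assoc)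
    qed simp
  qed
  then have "x - y = 0" by (rule trace_form_nondegenerate)
  then show ?thesis by simp
qed

text \<open>
  Nondegeneracy makes the coordinate map \<open>x \<mapsto> (\<tau> 0 x, \<dots>, \<tau> (n - 1) x)\<close> injective, and both
  sides have \<open>q\<^bsup>n\<^esup>\<close> elements; so every vector of coordinates occurs.
\<close>
lemma ex_dual_generator: "\<exists>\<gamma>. \<forall>i<n. \<tau> i \<gamma> = (if i = 0 then 1 else 0)"
proof -
  let ?F = "\<lambda>x. restrict (\<lambda>i. \<tau> i x) {..<n}"
  have "inj ?F"
  proof (rule injI)
    fix x y assume "?F x = ?F y"
    then have "\<tau> i x = \<tau> i y" if "i < n" for i
      using that by (metis lessThan_iff restrict_apply')
    then show "x = y" by (rule \<tau>_eqI)
  qed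
  then have "card (range ?F) = q ^ n" by (simp add: card_image card_ext)
  moreover have "card ({..<n} \<rightarrow>\<^sub>E (UNIV :: 'k set)) = q ^ n" by (simp add: card_PiE card_base)
  moreover have "range ?F \<subseteq> {..<n} \<rightarrow>\<^sub>E UNIV" by (simp add: image_subset_iff)
  ultimately have "range ?F = {..<n} \<rightarrow>\<^sub>E UNIV"
    by (intro card_subset_eq) (auto simp: finite_PiE)
  moreover define e :: "nat \<Rightarrow> 'k" where "e = restrict (\<lambda>i. if i = 0 then 1 else 0) {..<n}"
  moreover have "e \<in> {..<n} \<rightarrow>\<^sub>E UNIV" by (simp add: e_def)
  ultimately have "e \<in> range ?F" by simp
  then obtain x where "e = ?F x" by (rule rangeE)
  then have "\<tau> i x = e i" if "i < n" for i using that by simp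
  then have "\<forall>i<n. \<tau> i x = (if i = 0 then 1 else 0)" by (simp add: e_def)
  then show ?thesis ..
qed

text \<open>
  The dual basis is built as the conjugates of its first member, and for all indices, so that
  Frobenius acts on it by shifting the index.
\<close>
definition \<gamma> :: "nat \<Rightarrow> 'a" where
  "\<gamma> j = (SOME g. \<forall>i<n. \<tau> i g = (if i = 0 then 1 else 0)) ^ (q ^ j)"

lemma \<gamma>_add: "\<gamma> (i + j) = \<gamma> i ^ (q ^ j)"
  by (simp add: \<gamma>_def frobenius_frobenius)

lemma \<tau>_frobenius: "\<tau> (i + j) (x ^ (q ^ j)) = \<tau> i x"
  using trace_frobenius[of "\<beta> ^ (q ^ i) * x" j]
  by (simp add: \<tau>_eq power_mult_distrib frobenius_frobenius)

text \<open>
  The conjugates of one element are dual to the conjugates of \<open>\<beta>\<close> because the trace is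
  invariant under Frobenius; for \<open>i < j\<close> the index is first shifted by \<open>n\<close>.
\<close>
lemma \<tau>_\<gamma>:
  assumes "i < n" "j < n"
  shows "\<tau> i (\<gamma> j) = (if i = j then 1 else 0)"
proof -
  have \<gamma>0: "\<tau> i (\<gamma> 0) = (if i = 0 then 1 else 0)" if "i < n" for i
    using that someI_ex[OF ex_dual_generator] by (simp add: \<gamma>_def)
  have \<gamma>j: "\<gamma> j = \<gamma> 0 ^ (q ^ j)" using \<gamma>_add[of 0 j] by simp
  show ?thesis
  proof (cases "j \<le> i")
    case True
    then show ?thesis using \<tau>_frobenius[of "i - j" j "\<gamma> 0"] \<gamma>0[of "i - j"] assms by (simp add: \<gamma>j)
  next
    case False
    have "\<tau> i (\<gamma> j) = \<tau> (n + i) (\<gamma> j)" by (simp add: \<tau>_eq frobenius_n)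
    also have "\<dots> = \<tau> (n + i - j) (\<gamma> 0)"
      using \<tau>_frobenius[of "n + i - j" j "\<gamma> 0"] assms by (simp add: \<gamma>j)
    finally show ?thesis using \<gamma>0[of "n + i - j"] False assms by simp
  qed
qed

lemma dual_basis_expansion: "x = (\<Sum>j<n. \<iota> (\<tau> j x) * \<gamma> j)"
proof (rule \<tau>_eqI)
  fix i assume i: "i < n"
  have "\<tau> i (\<Sum>j<n. \<iota> (\<tau> j x) * \<gamma> j) = (\<Sum>j<n. if j = i then \<tau> j x else 0)"
    unfolding \<tau>_sum by (intro sum.cong) (auto simp: \<tau>_scale \<tau>_\<gamma> i)
  then show "\<tau> i x = \<tau> i (\<Sum>j<n. \<iota> (\<tau> j x) * \<gamma> j)" using i by simp
qed

end

section \<open>Transport of subalgebras along isomorphisms\<close>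

lemma algebra_isoD:
  assumes "h \<in> algebra_iso A B"
  shows "h \<in> ring_iso A B" "\<And>c x. x \<in> carrier A \<Longrightarrow> h (c \<odot>\<^bsub>A\<^esub> x) = c \<odot>\<^bsub>B\<^esub> h x"
  using assms by (auto simp: algebra_iso_def)

lemma algebra_iso_restrict:
  assumes h: "h \<in> algebra_iso A B" and S: "S \<subseteq> carrier A"
  shows "h \<in> algebra_iso (A\<lparr>carrier := S\<rparr>) (B\<lparr>carrier := h ` S\<rparr>)"
proof -
  note iso = ring_iso_memE[OF algebra_isoD(1)[OF h]]
  have "bij_betw h S (h ` S)"
    using inj_on_subset[OF bij_betw_imp_inj_on[OF iso(5)] S] by (simp add: bij_betw_def)
  then show ?thesis
    using S iso(2-4) algebra_isoD(2)[OF h] subsetD[OF S]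
    by (auto simp: algebra_iso_def ring_iso_def ring_hom_def)
qed

lemma algebra_iso_sym:
  assumes A: "ring A" and h: "h \<in> algebra_iso A B"
    and smult: "\<And>c x. x \<in> carrier A \<Longrightarrow> c \<odot>\<^bsub>A\<^esub> x \<in> carrier A"
  shows "inv_into (carrier A) h \<in> algebra_iso B A"
proof -
  note iso = ring_iso_memE[OF algebra_isoD(1)[OF h]]
  let ?g = "inv_into (carrier A) h"
  have "?g (c \<odot>\<^bsub>B\<^esub> y) = c \<odot>\<^bsub>A\<^esub> ?g y" if "y \<in> carrier B" for c y
  proof -
    have "y \<in> h ` carrier A" using bij_betw_imp_surj_on[OF iso(5)] that by simp
    then obtain x where x: "x \<in> carrier A" "y = h x" by blast
    have inj: "inj_on h (carrier A)" using iso(5) by (simp add: bij_betw_def)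
    have "c \<odot>\<^bsub>B\<^esub> y = h (c \<odot>\<^bsub>A\<^esub> x)" by (simp add: x algebra_isoD(2)[OF h])
    then show ?thesis using inj x smult by simp
  qed
  then show ?thesis
    using ring_iso_set_sym[OF A algebra_isoD(1)[OF h]] by (simp add: algebra_iso_def)
qed

lemma algebra_iso_trans:
  assumes "g \<in> algebra_iso A B" "h \<in> algebra_iso B C"
  shows "h \<circ> g \<in> algebra_iso A C"
  using assms ring_iso_set_trans[of g A B h C] ring_iso_memE(1)[of g A B]
  by (auto simp: algebra_iso_def)

lemma is_subalgebra_image:
  assumes A: "ring A" and B: "h \<zero>\<^bsub>A\<^esub> = \<zero>\<^bsub>B\<^esub>"
    and h: "h \<in> algebra_iso A B" and S: "is_subalgebra S A"
  shows "is_subalgebra (h ` S) B"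
proof -
  have "ring B" using ring.ring_iso_imp_img_ring[OF A algebra_isoD(1)[OF h]] by (simp add: B)
  moreover have "h \<in> ring_hom A B" using algebra_isoD(1)[OF h] by (simp add: ring_iso_def)
  ultimately interpret ring_hom_ring A B h by (intro ring_hom_ringI2 A)
  have S': "subring S A" "\<And>c x. x \<in> S \<Longrightarrow> c \<odot>\<^bsub>A\<^esub> x \<in> S"
    using S by (auto simp: is_subalgebra_def)
  have "c \<odot>\<^bsub>B\<^esub> h x \<in> h ` S" if "x \<in> S" for c x
  proof -
    have "x \<in> carrier A" using subringE(1)[OF S'(1)] that by blast
    then show ?thesis using algebra_isoD(2)[OF h, of x c] S'(2)[OF that, of c] by (metis imageI)
  qed
  then show ?thesis using img_is_subring[OF S'(1)] by (auto simp: is_subalgebra_def)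
qed

text \<open>
  Both algebras of the theorem are presented as isomorphic images of one algebra; two images of
  the same subalgebra are then isomorphic.
\<close>
lemma ex_iso_of_images:
  assumes R: "ring R" and S: "is_subalgebra S R"
    and g: "g \<in> algebra_iso R A" and h: "h \<in> algebra_iso R B"
  shows "\<exists>\<phi>. \<phi> \<in> algebra_iso (A\<lparr>carrier := g ` S\<rparr>) (B\<lparr>carrier := h ` S\<rparr>)"
proof -
  have S': "subring S R" "\<And>c x. x \<in> S \<Longrightarrow> c \<odot>\<^bsub>R\<^esub> x \<in> S"
    using S by (auto simp: is_subalgebra_def)
  note sub = subringE(1)[OF S'(1)]
  have "ring (R\<lparr>carrier := S\<rparr>)" by (rule ring.subring_is_ring[OF R S'(1)])
  then have "inv_into S g \<in> algebra_iso (A\<lparr>carrier := g ` S\<rparr>) (R\<lparr>carrier := S\<rparr>)"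
    using algebra_iso_sym[OF _ algebra_iso_restrict[OF g sub]] S'(2) by simp
  then show ?thesis using algebra_iso_trans algebra_iso_restrict[OF h sub] by blast
qed

section \<open>Linear endomorphisms and linearized polynomials\<close>

definition linear_endos :: "('k::field \<Rightarrow> 'a::field) \<Rightarrow> ('a \<Rightarrow> 'a) set" where
  "linear_endos \<iota> = {g. (\<forall>x y. g (x + y) = g x + g y) \<and> (\<forall>c x. g (\<iota> c * x) = \<iota> c * g x)}"

definition endo_algebra :: "('k::field \<Rightarrow> 'a::field) \<Rightarrow> ('k, 'a \<Rightarrow> 'a) module" where
  "endo_algebra \<iota> = \<lparr>
     carrier = linear_endos \<iota>,
     mult = (\<lambda>g h. g \<circ> h),
     one = id,
     zero = (\<lambda>x. 0),
     add = (\<lambda>g h x. g x + h x),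
     smult = (\<lambda>c g x. \<iota> c * g x) \<rparr>"

lemma endo_algebra_simps [simp]:
  "carrier (endo_algebra \<iota>) = linear_endos \<iota>"
  "g \<otimes>\<^bsub>endo_algebra \<iota>\<^esub> h = g \<circ> h"
  "\<one>\<^bsub>endo_algebra \<iota>\<^esub> = id"
  "\<zero>\<^bsub>endo_algebra \<iota>\<^esub> = (\<lambda>x. 0)"
  "g \<oplus>\<^bsub>endo_algebra \<iota>\<^esub> h = (\<lambda>x. g x + h x)"
  "c \<odot>\<^bsub>endo_algebra \<iota>\<^esub> g = (\<lambda>x. \<iota> c * g x)"
  by (simp_all add: endo_algebra_def)

lemma linear_endosD:
  assumes "g \<in> linear_endos \<iota>"
  shows "g (x + y) = g x + g y" "g (\<iota> c * x) = \<iota> c * g x" "g 0 = 0"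
    "g (\<Sum>i\<in>S. f i) = (\<Sum>i\<in>S. g (f i))"
proof -
  show add: "g (x + y) = g x + g y" for x y
    using assms by (simp add: linear_endos_def)
  show "g (\<iota> c * x) = \<iota> c * g x" using assms by (simp add: linear_endos_def)
  have "g 0 + 0 = g 0 + g 0" using add[of 0 0] by simp
  then show zero: "g 0 = 0" by (simp only: add_left_cancel)
  show "g (\<Sum>i\<in>S. f i) = (\<Sum>i\<in>S. g (f i))"
    by (induction S rule: infinite_finite_induct) (simp_all add: zero add)
qed

lemma ring_endo_algebra: "ring (endo_algebra \<iota>)"
proof (rule ringI)
  have neg: "(\<lambda>x. - g x) \<in> linear_endos \<iota>" if "g \<in> linear_endos \<iota>" for g
    using that by (simp add: linear_endos_def)
  show "abelian_group (endo_algebra \<iota>)"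
  proof (rule abelian_groupI)
    fix g assume "g \<in> carrier (endo_algebra \<iota>)"
    then show "\<exists>h\<in>carrier (endo_algebra \<iota>). h \<oplus>\<^bsub>endo_algebra \<iota>\<^esub> g = \<zero>\<^bsub>endo_algebra \<iota>\<^esub>"
      using neg by (intro bexI[of _ "\<lambda>x. - g x"]) auto
  qed (auto simp: linear_endos_def algebra_simps)
  show "monoid (endo_algebra \<iota>)"
    by (rule monoidI) (auto simp: linear_endos_def)
qed (auto simp: linear_endos_def)

context normal_basis_extension
begin

definition frobenius_endos :: "nat \<Rightarrow> ('a \<Rightarrow> 'a) set" where
  "frobenius_endos m = {g \<in> linear_endos \<iota>. \<forall>x. g (x ^ (q ^ m)) = g x ^ (q ^ m)}"

lemma frobenius_neg: "(- x :: 'a) ^ (q ^ j) = - (x ^ (q ^ j))"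
proof -
  have "(- x) ^ (q ^ j) + x ^ (q ^ j) = 0"
    using q_gt_1 by (simp flip: frobenius_add)
  then show ?thesis by (simp add: eq_neg_iff_add_eq_0)
qed

lemma subalgebra_frobenius_endos: "is_subalgebra (frobenius_endos m) (endo_algebra \<iota>)"
proof -
  interpret E: ring "endo_algebra \<iota>" by (rule ring_endo_algebra)
  have minus: "\<ominus>\<^bsub>endo_algebra \<iota>\<^esub> g = (\<lambda>x. - g x)" if "g \<in> linear_endos \<iota>" for g
    by (rule E.minus_equality) (use that in \<open>auto simp: linear_endos_def\<close>)
  have "subring (frobenius_endos m) (endo_algebra \<iota>)"
    by (rule E.subringI)
      (auto simp: frobenius_endos_def minus linear_endos_def frobenius_add frobenius_neg distrib_left)
  then show ?thesis
    by (auto simp: is_subalgebra_def frobenius_endos_def linear_endos_def power_mult_distrib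
        algebra_simps)
qed

definition lin_poly :: "(nat \<Rightarrow> 'a) \<Rightarrow> 'a poly" where
  "lin_poly a = (\<Sum>i<n. Polynomial.monom (a i) (q ^ i))"

lemma linearized_polys_eq: "linearized_polys q n F = lin_poly ` {a. \<forall>i<n. a i \<in> F}"
  by (auto simp: linearized_polys_def lin_poly_def)

lemma poly_lin_poly: "poly (lin_poly a) x = (\<Sum>i<n. a i * x ^ (q ^ i))"
  by (simp add: lin_poly_def poly_sum poly_monom)

lemma coeff_lin_poly: "j < n \<Longrightarrow> Polynomial.coeff (lin_poly a) (q ^ j) = a j"
  using q_gt_1 by (simp add: lin_poly_def Polynomial.coeff_sum)

lemma degree_lin_poly: "degree (lin_poly a) < q ^ n"
proof -
  have "degree (lin_poly a) \<le> q ^ (n - 1)"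
    unfolding lin_poly_def using q_gt_1
    by (intro degree_sum_le) (auto intro!: order.trans[OF degree_monom_le] power_increasing)
  also have "\<dots> < q ^ n" using q_gt_1 n_pos by (intro power_strict_increasing) auto
  finally show ?thesis .
qed

lemma poly_eq_of_fun_eq:
  fixes p r :: "'a poly"
  assumes "poly p = poly r" "degree p < q ^ n" "degree r < q ^ n"
  shows "p = r"
  by (rule poly_eqI_degree[of UNIV]) (use assms in \<open>simp_all add: card_ext\<close>)

lemma poly_lin_poly_linear: "poly (lin_poly a) \<in> linear_endos \<iota>"
  by (simp add: linear_endos_def poly_lin_poly frobenius_add power_mult_distrib sum.distrib
      distrib_left sum_distrib_left mult.left_commute)

lemma endo_expansion:
  assumes "g \<in> linear_endos \<iota>"
  shows "g x = (\<Sum>j<n. \<iota> (\<tau> j x) * g (\<gamma> j))"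
  by (subst dual_basis_expansion[of x]) (simp add: linear_endosD[OF assms])

text \<open>
  Every linear map is \<open>x \<mapsto> \<Sum>j. tr (\<beta>\<^bsup>q^j\<^esup> x) g (\<gamma> j)\<close>, and writing out the traces displays it
  as a linearized polynomial.
\<close>
lemma endo_eq_lin_poly:
  assumes "g \<in> linear_endos \<iota>"
  shows "\<exists>a. g = poly (lin_poly a)"
proof
  show "g = poly (lin_poly (\<lambda>i. \<Sum>j<n. \<beta> ^ (q ^ (j + i)) * g (\<gamma> j)))" (is "g = poly ?p")
  proof
    fix x
    have "g x = (\<Sum>j<n. \<Sum>i<n. \<beta> ^ (q ^ (j + i)) * g (\<gamma> j) * x ^ (q ^ i))"
      unfolding endo_expansion[OF assms, of x]
      by (simp add: \<tau>_eq embedding_trace power_mult_distrib frobenius_frobenius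
          sum_distrib_left sum_distrib_right mult.commute mult.left_commute)
    also have "\<dots> = poly ?p x"
      by (subst sum.swap) (simp add: poly_lin_poly sum_distrib_right)
    finally show "g x = poly ?p x" .
  qed
qed

text \<open>
  This description makes closure under composition modulo \<open>X\<^bsup>q^n\<^esup> - X\<close> immediate: the remainder
  defines the same function, and no coefficient has to be computed.
\<close>
lemma linearized_polys_iff:
  "p \<in> linearized_polys q n UNIV \<longleftrightarrow> degree p < q ^ n \<and> poly p \<in> linear_endos \<iota>"
proof
  assume "degree p < q ^ n \<and> poly p \<in> linear_endos \<iota>"
  then show "p \<in> linearized_polys q n UNIV"
    using endo_eq_lin_poly degree_lin_poly poly_eq_of_fun_eq
    by (fastforce simp: linearized_polys_eq)
qed (auto simp: linearized_polys_eq degree_lin_poly poly_lin_poly_linear)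

text \<open>
  Conjugating \<open>\<Sum>i. a i x\<^bsup>q^i\<^esup>\<close> by the Frobenius power \<open>x \<mapsto> x\<^bsup>q^m\<^esup>\<close> raises the coefficients to
  the power \<open>q\<^bsup>m\<^esup>\<close>; as coefficients are determined by the function, commuting with it means
  having coefficients in the fixed field.
\<close>
lemma lin_poly_commutes_iff:
  "poly (lin_poly a) \<in> frobenius_endos m \<longleftrightarrow> (\<forall>i<n. a i \<in> subfield_of_order (q ^ m))"
proof -
  let ?b = "\<lambda>i. a i ^ (q ^ m)"
  have pow: "poly (lin_poly a) x ^ (q ^ m) = poly (lin_poly ?b) (x ^ (q ^ m))" for x
    by (simp add: poly_lin_poly frobenius_sum power_mult_distrib frobenius_frobenius add.commute)
  have "poly (lin_poly a) \<in> frobenius_endos m \<longleftrightarrow>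
      (\<forall>x. poly (lin_poly a) (x ^ (q ^ m)) = poly (lin_poly ?b) (x ^ (q ^ m)))"
    by (simp add: frobenius_endos_def poly_lin_poly_linear pow)
  also have "\<dots> \<longleftrightarrow> poly (lin_poly a) = poly (lin_poly ?b)"
  proof
    assume *: "\<forall>x. poly (lin_poly a) (x ^ (q ^ m)) = poly (lin_poly ?b) (x ^ (q ^ m))"
    show "poly (lin_poly a) = poly (lin_poly ?b)"
    proof
      fix y :: 'a
      obtain x where "x ^ (q ^ m) = y" using surj_frobenius by blast
      then show "poly (lin_poly a) y = poly (lin_poly ?b) y" using * by blast
    qed
  qed simp
  also have "\<dots> \<longleftrightarrow> lin_poly a = lin_poly ?b"
    by (auto intro: poly_eq_of_fun_eq degree_lin_poly)
  also have "\<dots> \<longleftrightarrow> (\<forall>i<n. a i = ?b i)"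
  proof
    assume "lin_poly a = lin_poly ?b"
    then show "\<forall>i<n. a i = ?b i" using coeff_lin_poly by metis
  qed (auto simp: lin_poly_def intro!: sum.cong)
  finally show ?thesis by (auto simp: subfield_of_order_def)
qed

text \<open>
  Evaluation of polynomials goes from the linearized algebra to the endomorphisms; its inverse is
  used instead, so that the endomorphism algebra, which is visibly a ring, is the source of both
  isomorphisms.
\<close>
definition interp :: "('a \<Rightarrow> 'a) \<Rightarrow> 'a poly" where
  "interp g = (THE p. p \<in> linearized_polys q n UNIV \<and> poly p = g)"

lemma interp_poly:
  assumes "p \<in> linearized_polys q n UNIV"
  shows "interp (poly p) = p"
  unfolding interp_def
  by (rule the_equality) (use assms poly_eq_of_fun_eq in \<open>auto simp: linearized_polys_iff\<close>)

lemma interp_endo: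
  assumes "g \<in> linear_endos \<iota>"
  shows "interp g \<in> linearized_polys q n UNIV" "poly (interp g) = g"
  using endo_eq_lin_poly[OF assms] interp_poly by (force simp: linearized_polys_eq)+

lemma interp_eqI:
  assumes "g \<in> linear_endos \<iota>" "poly p = g" "degree p < q ^ n"
  shows "interp g = p"
  using assms interp_poly[of p] by (simp add: linearized_polys_iff)

lemma interp_frobenius_endos:
  "interp ` frobenius_endos m = linearized_polys q n (subfield_of_order (q ^ m))"
proof
  show "interp ` frobenius_endos m \<subseteq> linearized_polys q n (subfield_of_order (q ^ m))"
  proof safe
    fix g assume g: "g \<in> frobenius_endos m"
    then have "g \<in> linear_endos \<iota>" by (simp add: frobenius_endos_def)
    then obtain a where a: "g = poly (lin_poly a)" using endo_eq_lin_poly by blast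
    then have "interp g = lin_poly a" using interp_poly by (simp add: linearized_polys_eq)
    then show "interp g \<in> linearized_polys q n (subfield_of_order (q ^ m))"
      using g lin_poly_commutes_iff by (simp add: a linearized_polys_eq)
  qed
  show "linearized_polys q n (subfield_of_order (q ^ m)) \<subseteq> interp ` frobenius_endos m"
  proof
    fix p :: "'a poly" assume "p \<in> linearized_polys q n (subfield_of_order (q ^ m))"
    then obtain a where a: "p = lin_poly a" "\<forall>i<n. a i \<in> subfield_of_order (q ^ m)"
      by (auto simp: linearized_polys_eq)
    then have "interp (poly p) = p" using interp_poly by (simp add: linearized_polys_eq)
    then show "p \<in> interp ` frobenius_endos m"
      using a lin_poly_commutes_iff by (metis imageI)
  qed
qed

lemma interp_iso: "interp \<in> algebra_iso (endo_algebra \<iota>) (linearized_algebra \<iota> n)"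
proof -
  let ?L = "linearized_algebra \<iota> n"
  let ?m = "Polynomial.monom 1 (q ^ n) - Polynomial.monom 1 1 :: 'a poly"
  note add_closed = ring.ring_simprules(1)[OF ring_endo_algebra[of \<iota>], simplified]
  have qn: "1 < q ^ n" using q_gt_1 n_pos by (rule one_less_power)
  have Lcarrier: "carrier ?L = linearized_polys q n UNIV"
    by (simp add: linearized_algebra_def card_base)
  have deg: "degree (interp g) < q ^ n" if "g \<in> linear_endos \<iota>" for g
    using interp_endo(1)[OF that] by (simp add: linearized_polys_iff)
  have "bij_betw interp (linear_endos \<iota>) (linearized_polys q n UNIV)"
    by (rule bij_betw_byWitness[where f' = poly])
      (auto simp: interp_endo interp_poly linearized_polys_iff[THEN iffD1])
  moreover have "interp (g \<circ> h) = interp g \<otimes>\<^bsub>?L\<^esub> interp h"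
    if gh: "g \<in> linear_endos \<iota>" "h \<in> linear_endos \<iota>" for g h
  proof (rule interp_eqI)
    show "g \<circ> h \<in> linear_endos \<iota>" using gh by (simp add: linear_endos_def)
    \<comment> \<open>Every element is a root of the modulus, so reduction does not change values.\<close>
    have zero: "poly ?m x = 0" for x using frobenius_n[of x 0] by (simp add: poly_monom)
    have mod: "poly (p mod ?m) x = poly p x" for p x
      using arg_cong[OF div_mult_mod_eq[of p ?m], of "\<lambda>p. poly p x"] zero[of x] by simp
    have mult: "p \<otimes>\<^bsub>?L\<^esub> r = pcompose p r mod ?m" for p r
      by (simp add: linearized_algebra_def card_base)
    show "poly (interp g \<otimes>\<^bsub>?L\<^esub> interp h) = g \<circ> h"
      by (rule ext) (simp only: mult mod poly_pcompose interp_endo(2) gh o_apply)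
    have deg_m: "degree ?m \<le> q ^ n"
      using qn by (intro degree_diff_le) (auto simp: degree_monom_eq)
    have "Polynomial.coeff ?m (q ^ n) = 1" using qn by simp
    then have "?m \<noteq> 0" by (metis Polynomial.coeff_0 zero_neq_one)
    from degree_mod_less[OF this] show "degree (interp g \<otimes>\<^bsub>?L\<^esub> interp h) < q ^ n"
    proof
      assume "pcompose (interp g) (interp h) mod ?m = 0"
      then show ?thesis unfolding mult using qn by (metis degree_0 less_trans zero_less_one)
    next
      assume "degree (pcompose (interp g) (interp h) mod ?m) < degree ?m"
      then show ?thesis unfolding mult using deg_m by (rule less_le_trans)
    qed
  qed
  moreover have "interp (\<lambda>x. g x + h x) = interp g \<oplus>\<^bsub>?L\<^esub> interp h"
    if gh: "g \<in> linear_endos \<iota>" "h \<in> linear_endos \<iota>" for g h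
    by (rule interp_eqI)
      (use gh deg in \<open>auto simp: linearized_algebra_def interp_endo add_closed intro: degree_add_less\<close>)
  moreover have "interp id = \<one>\<^bsub>?L\<^esub>"
    by (rule interp_eqI)
      (use qn in \<open>auto simp: linearized_algebra_def linear_endos_def poly_monom degree_monom_eq\<close>)
  moreover have "interp (\<lambda>x. \<iota> c * g x) = c \<odot>\<^bsub>?L\<^esub> interp g" if g: "g \<in> linear_endos \<iota>" for c g
    by (rule interp_eqI)
      (use g q_gt_1 deg[OF g] in \<open>auto simp: linearized_algebra_def linear_endos_def algebra_simps
        interp_endo intro: le_less_trans[OF degree_smult_le]\<close>)
  ultimately show ?thesis
    by (auto simp: algebra_iso_def ring_iso_def ring_hom_def Lcarrier interp_endo)
qed

lemma interp_zero: "interp (\<lambda>x. 0) = \<zero>\<^bsub>linearized_algebra \<iota> n\<^esub>"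
  by (rule interp_eqI) (use q_gt_1 in \<open>auto simp: linearized_algebra_def linear_endos_def\<close>)

section \<open>Linear endomorphisms and tensors\<close>

sublocale V: vector_space "free_scale :: 'k \<Rightarrow> ('k, 'a) free_dual \<Rightarrow> ('k, 'a) free_dual"
  by (rule vector_space_free_scale)

text \<open>The endomorphism \<open>y \<mapsto> \<Sum> c l(y) x\<close> represented by a formal sum of \<open>c (l, x)\<close>.\<close>
definition ev :: "('k, 'a) free_dual \<Rightarrow> 'a \<Rightarrow> 'a" where
  "ev f y = (\<Sum>p\<in>Poly_Mapping.keys f. \<iota> (Poly_Mapping.lookup f p * fst p y) * snd p)"

abbreviation "reps \<equiv> free_space (dual \<iota>) UNIV :: ('k, 'a) free_dual set"

lemma ev_superset:
  assumes "finite S" "Poly_Mapping.keys f \<subseteq> S"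
  shows "ev f y = (\<Sum>p\<in>S. \<iota> (Poly_Mapping.lookup f p * fst p y) * snd p)"
  unfolding ev_def
  by (rule sum.mono_neutral_left) (use assms in \<open>auto simp: in_keys_iff\<close>)

lemma ev_0 [simp]: "ev 0 y = 0"
  by (simp add: ev_def)

lemma ev_add [simp]: "ev (f + g) y = ev f y + ev g y"
proof -
  let ?S = "Poly_Mapping.keys f \<union> Poly_Mapping.keys g"
  have "Poly_Mapping.keys (f + g) \<subseteq> ?S" by (rule Poly_Mapping.keys_add)
  then show ?thesis
    by (subst (1 2 3) ev_superset[of ?S]) (auto simp: lookup_add distrib_right sum.distrib)
qed

lemma ev_scale [simp]: "ev (free_scale c f) y = \<iota> c * ev f y"
proof -
  have "Poly_Mapping.keys (free_scale c f) \<subseteq> Poly_Mapping.keys f" by (auto simp: in_keys_iff)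
  then show ?thesis
    by (subst (1 2) ev_superset[of "Poly_Mapping.keys f"])
      (auto simp: sum_distrib_left mult.assoc)
qed

lemma ev_single [simp]: "ev (Poly_Mapping.single (l, x) c) y = \<iota> (c * l y) * x"
  by (simp add: ev_def)

lemma ev_gen: "ev (gen l x) y = \<iota> (l y) * x"
  by simp

lemma ev_diff [simp]: "ev (f - g) y = ev f y - ev g y"
  using ev_add[of "f - g" g y] by (simp del: ev_add)

lemma ev_sum: "ev (\<Sum>i\<in>S. f i) y = (\<Sum>i\<in>S. ev (f i) y)"
  by (induction S rule: infinite_finite_induct) auto

lemma dualD:
  assumes "l \<in> dual \<iota>"
  shows "l (x + y) = l x + l y" "l (\<iota> c * x) = c * l x" "l (x * \<iota> c) = c * l x"
proof -
  show "l (x + y) = l x + l y" and *: "l (\<iota> c * x) = c * l x"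
    using assms by (auto simp: dual_iff[OF embedding] scale_def)
  show "l (x * \<iota> c) = c * l x" using * by (simp add: mult.commute)
qed

lemma dual_closed:
  assumes "l \<in> dual \<iota>"
  shows "dual_scale c l \<in> dual \<iota>" "l' \<in> dual \<iota> \<Longrightarrow> l + l' \<in> dual \<iota>"
  using assms by (auto simp: dual_iff[OF embedding] dual_scale_def algebra_simps)

lemma subspace_reps: "V.subspace reps"
  unfolding V.subspace_def free_space_def
  by (auto simp: in_keys_iff subset_iff lookup_add) (metis add.left_neutral)+

lemma gen_in_reps: "l \<in> dual \<iota> \<Longrightarrow> gen l x \<in> reps"
  by (simp add: free_space_def)

lemma free_mult_in_reps:
  assumes f: "f \<in> reps" and g: "g \<in> reps"
  shows "free_mult f g \<in> reps"
proof -
  note closed = V.subspace_0[OF subspace_reps] V.subspace_add[OF subspace_reps]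
    V.subspace_scale[OF subspace_reps]
  have 0: "free_mult 0 h = 0" "free_mult h 0 = 0" for h :: "('k, 'a) free_dual"
    by (simp_all add: free_mult_def)
  have gen: "free_mult (gen l x) g \<in> reps" if "l \<in> dual \<iota>" for l x
    using g
    by (induction rule: free_space_induct)
      (simp_all add: 0 closed free_mult_add_right free_mult_scale_right free_mult_gen gen_in_reps
        dual_closed)
  show ?thesis
    using f
    by (induction rule: free_space_induct)
      (simp_all add: 0 closed free_mult_add_left free_mult_scale_left gen)
qed

lemma ev_linear:
  assumes "f \<in> reps"
  shows "ev f \<in> linear_endos \<iota>"
  using assms
  by (induction rule: free_space_induct)
    (auto simp: linear_endos_def algebra_simps dualD)

text \<open>
  On generators the product \<open>l1(x2) (l2, x1)\<close> represents \<open>y \<mapsto> l2(y) l1(x2) x1\<close>, the composition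
  of \<open>y \<mapsto> l1(y) x1\<close> after \<open>y \<mapsto> l2(y) x2\<close>; bilinearity does the rest.
\<close>
lemma ev_free_mult:
  assumes f: "f \<in> reps" and g: "g \<in> reps"
  shows "ev (free_mult f g) = ev f \<circ> ev g"
proof -
  have 0: "free_mult 0 h = 0" "free_mult h 0 = 0" for h :: "('k, 'a) free_dual"
    by (simp_all add: free_mult_def)
  have gen: "ev (free_mult (gen l x) g) = ev (gen l x) \<circ> ev g" if l: "l \<in> dual \<iota>" for l x
    using g
  proof (induction rule: free_space_induct)
    case zero
    have "l 0 = 0" using dualD(2)[OF l, of 0 0] by simp
    then show ?case by (simp add: 0 fun_eq_iff)
  next
    case (add f g)
    then show ?case by (simp add: free_mult_add_right fun_eq_iff dualD(1)[OF l] distrib_right)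
  next
    case (scale c f)
    then show ?case by (simp add: free_mult_scale_right fun_eq_iff dualD(2)[OF l] mult.assoc)
  next
    case (gen l' x')
    show ?case
      by (simp add: free_mult_gen fun_eq_iff dualD[OF l] dual_scale_def mult.commute mult.assoc)
  qed
  show ?thesis
    using f
    by (induction rule: free_space_induct)
      (auto simp: 0 gen fun_eq_iff free_mult_add_left free_mult_scale_left)
qed

lemma ev_null:
  assumes "z \<in> null_space \<iota>"
  shows "ev z y = 0"
  using assms
proof (induction rule: V.span_induct_alt)
  case (step c b z)
  have "ev b y = 0"
  proof -
    consider v v' w where "b = gen (v + v') w - gen v w - gen v' w"
      | v w w' where "b = gen v (w + w') - gen v w - gen v w'"
      | c v w where "b = gen (dual_scale c v) w - free_scale c (gen v w)"
      | c v w where "b = gen v (scale \<iota> c w) - free_scale c (gen v w)"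
      using step(1) unfolding bilinear_relations_def by blast
    then show ?thesis
      by cases (simp_all add: dual_scale_def scale_def distrib_left distrib_right mult.assoc mult.left_commute)
  qed
  then show ?case using step by simp
qed simp

text \<open>Equality in the tensor product, as a congruence on formal sums.\<close>
definition teq :: "('k, 'a) free_dual \<Rightarrow> ('k, 'a) free_dual \<Rightarrow> bool" (infix \<open>\<approx>\<close> 50) where
  "f \<approx> g \<longleftrightarrow> f - g \<in> null_space \<iota>"

lemma teq_refl [simp]: "f \<approx> f"
  by (simp add: teq_def V.span_zero)

lemma teq_sym: "f \<approx> g \<Longrightarrow> g \<approx> f"
  using V.span_neg[of "f - g"] by (auto simp: teq_def)

lemma teq_trans [trans]: "f \<approx> g \<Longrightarrow> g \<approx> h \<Longrightarrow> f \<approx> h"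
  using V.span_add[of "f - g" _ "g - h"] by (auto simp: teq_def)

lemma teq_add: "f \<approx> g \<Longrightarrow> f' \<approx> g' \<Longrightarrow> f + f' \<approx> g + g'"
  using V.span_add[of "f - g" _ "f' - g'"] by (auto simp: teq_def algebra_simps)

lemma teq_scale: "f \<approx> g \<Longrightarrow> free_scale c f \<approx> free_scale c g"
  using V.span_scale[of "f - g" _ c] by (auto simp: teq_def V.scale_right_diff_distrib)

lemma teq_sum: "(\<And>i. i \<in> S \<Longrightarrow> f i \<approx> g i) \<Longrightarrow> (\<Sum>i\<in>S. f i) \<approx> (\<Sum>i\<in>S. g i)"
  by (induction S rule: infinite_finite_induct) (auto intro: teq_add)

lemma teq_gen:
  assumes "l \<in> dual \<iota>"
  shows "l' \<in> dual \<iota> \<Longrightarrow> gen (l + l') x \<approx> gen l x + gen l' x"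
    and "gen l (x + y) \<approx> gen l x + gen l y"
    and "gen (dual_scale c l) x \<approx> free_scale c (gen l x)"
    and "gen l (\<iota> c * x) \<approx> free_scale c (gen l x)"
proof -
  show "gen (l + l') x \<approx> gen l x + gen l' x" if "l' \<in> dual \<iota>"
    unfolding teq_def diff_diff_add[symmetric] using assms that
    by (intro V.span_base) (unfold bilinear_relations_def, blast)
  show "gen l (x + y) \<approx> gen l x + gen l y"
    unfolding teq_def diff_diff_add[symmetric] using assms
    by (intro V.span_base) (unfold bilinear_relations_def, blast)
  show "gen (dual_scale c l) x \<approx> free_scale c (gen l x)"
    unfolding teq_def using assms
    by (intro V.span_base) (unfold bilinear_relations_def, blast)
  show "gen l (\<iota> c * x) \<approx> free_scale c (gen l x)"
    unfolding teq_def scale_def[symmetric] using assms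
    by (intro V.span_base) (unfold bilinear_relations_def, blast)
qed

lemma teq_gen_sum_left:
  assumes "finite S" "\<And>i. i \<in> S \<Longrightarrow> l i \<in> dual \<iota>"
  shows "gen (\<lambda>y. \<Sum>i\<in>S. l i y) x \<approx> (\<Sum>i\<in>S. gen (l i) x) \<and> (\<lambda>y. \<Sum>i\<in>S. l i y) \<in> dual \<iota>"
  using assms
proof (induction S rule: finite_induct)
  case empty
  have "dual_scale 0 (\<tau> 0) = (\<lambda>y. 0)" by (simp add: dual_scale_def)
  then show ?case
    using teq_gen(3)[OF \<tau>_in_dual, of 0 0 x] dual_closed(1)[OF \<tau>_in_dual, of 0 0] by simp
next
  case (insert i S)
  let ?s = "\<lambda>y. \<Sum>i\<in>S. l i y"
  have eq: "(\<lambda>y. \<Sum>i\<in>insert i S. l i y) = l i + ?s"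
    using insert by (simp add: fun_eq_iff)
  have "gen (l i + ?s) x \<approx> gen (l i) x + gen ?s x"
    using insert by (intro teq_gen(1)) auto
  also have "\<dots> \<approx> gen (l i) x + (\<Sum>i\<in>S. gen (l i) x)"
    using insert by (intro teq_add) auto
  finally show ?case
    unfolding eq using insert dual_closed(2)[of "l i" ?s] by simp
qed

definition tensor_of :: "(nat \<Rightarrow> 'a) \<Rightarrow> ('k, 'a) free_dual" where
  "tensor_of \<alpha> = (\<Sum>i<n. gen (\<tau> i) (\<alpha> i))"

lemma tensor_of_in_reps: "tensor_of \<alpha> \<in> reps"
  unfolding tensor_of_def by (intro V.subspace_sum[OF subspace_reps] gen_in_reps \<tau>_in_dual)

lemma ev_tensor_of: "ev (tensor_of \<alpha>) y = (\<Sum>i<n. \<iota> (\<tau> i y) * \<alpha> i)"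
  by (simp add: tensor_of_def ev_sum)

text \<open>
  Since \<open>l = \<Sum>i. l (\<gamma> i) \<tau> i\<close> for every functional \<open>l\<close>, bilinearity rewrites \<open>l \<otimes> x\<close> as
  \<open>\<Sum>i. \<tau> i \<otimes> l (\<gamma> i) x\<close>. The right-hand side depends only on the endomorphism represented,
  which makes the tensor product embed into the endomorphisms.
\<close>
lemma tensor_normal_form:
  assumes "f \<in> reps"
  shows "f \<approx> tensor_of (\<lambda>i. ev f (\<gamma> i))"
  using assms
proof (induction rule: free_space_induct)
  case zero
  have "tensor_of (\<lambda>i. ev 0 (\<gamma> i)) \<approx> (\<Sum>i<n. free_scale 0 (gen (\<tau> i) 0))"
    unfolding tensor_of_def
    by (rule teq_sum) (use teq_gen(4)[OF \<tau>_in_dual, of _ 0 0] in simp)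
  then show ?case by (simp add: teq_sym)
next
  case (add f g)
  have "tensor_of (\<lambda>i. ev (f + g) (\<gamma> i)) \<approx>
      (\<Sum>i<n. gen (\<tau> i) (ev f (\<gamma> i)) + gen (\<tau> i) (ev g (\<gamma> i)))"
    unfolding tensor_of_def ev_add by (intro teq_sum teq_gen(2) \<tau>_in_dual)
  also have "\<dots> = tensor_of (\<lambda>i. ev f (\<gamma> i)) + tensor_of (\<lambda>i. ev g (\<gamma> i))"
    by (simp add: tensor_of_def sum.distrib)
  finally show ?case using add by (meson teq_add teq_sym teq_trans)
next
  case (scale c f)
  have "tensor_of (\<lambda>i. ev (free_scale c f) (\<gamma> i)) \<approx>
      (\<Sum>i<n. free_scale c (gen (\<tau> i) (ev f (\<gamma> i))))"
    unfolding tensor_of_def ev_scale by (intro teq_sum teq_gen(4) \<tau>_in_dual)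
  also have "\<dots> = free_scale c (tensor_of (\<lambda>i. ev f (\<gamma> i)))"
    by (simp only: tensor_of_def V.scale_sum_right)
  finally show ?case using scale by (meson teq_scale teq_sym teq_trans)
next
  case (gen l x)
  have "l y = (\<Sum>i<n. dual_scale (l (\<gamma> i)) (\<tau> i) y)" for y
  proof -
    have lsum: "l (\<Sum>i\<in>S. h i) = (\<Sum>i\<in>S. l (h i))" for h and S :: "nat set"
      using dualD(2)[OF gen(1), of 0 0]
      by (induction S rule: infinite_finite_induct) (simp_all add: dualD(1)[OF gen(1)])
    show ?thesis
      by (subst dual_basis_expansion[of y])
        (simp add: lsum dualD[OF gen(1)] dual_scale_def mult.commute)
  qed
  then have "gen l x = gen (\<lambda>y. \<Sum>i<n. dual_scale (l (\<gamma> i)) (\<tau> i) y) x"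
    by (metis ext)
  also have "\<dots> \<approx> (\<Sum>i<n. gen (dual_scale (l (\<gamma> i)) (\<tau> i)) x)"
    by (intro teq_gen_sum_left[THEN conjunct1] dual_closed \<tau>_in_dual) simp
  also have "\<dots> \<approx> (\<Sum>i<n. free_scale (l (\<gamma> i)) (gen (\<tau> i) x))"
    by (intro teq_sum teq_gen(3) \<tau>_in_dual)
  also have "\<dots> \<approx> (\<Sum>i<n. gen (\<tau> i) (\<iota> (l (\<gamma> i)) * x))"
    by (intro teq_sum teq_sym[OF teq_gen(4)] \<tau>_in_dual)
  finally show ?case by (simp only: tensor_of_def ev_gen)
qed

definition fiber :: "('a \<Rightarrow> 'a) \<Rightarrow> ('k, 'a) free_dual set" where
  "fiber g = {f \<in> reps. ev f = g}"

text \<open>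
  Bilinearity relations represent the zero map, so a class represents only one map; conversely, two
  formal sums representing the same map have the same normal form. Thus the classes of the tensor
  product are the fibers.
\<close>
lemma cls_eq_fiber:
  assumes f: "f \<in> reps"
  shows "cls \<iota> f = fiber (ev f)"
proof safe
  fix h assume "h \<in> cls \<iota> f"
  then have h: "h - f \<in> null_space \<iota>" by (simp add: tensor_class_def)
  then have "h - f \<in> reps" using null_space_subset[OF embedding] by blast
  then have "(h - f) + f \<in> reps" by (rule V.subspace_add[OF subspace_reps _ f])
  moreover have "ev h = ev f" using ev_null[OF h] by (simp add: fun_eq_iff)
  ultimately show "h \<in> fiber (ev f)" by (simp add: fiber_def)
next
  fix h assume "h \<in> fiber (ev f)"
  then have "h \<in> reps" "ev h = ev f" by (auto simp: fiber_def)
  then have "h \<approx> f"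
    using tensor_normal_form[of h] tensor_normal_form[OF f] by (metis teq_sym teq_trans)
  then show "h \<in> cls \<iota> f" by (simp add: teq_def tensor_class_def)
qed

lemma tensor_of_in_fiber:
  assumes "g \<in> linear_endos \<iota>"
  shows "tensor_of (\<lambda>i. g (\<gamma> i)) \<in> fiber g"
proof -
  have "ev (tensor_of (\<lambda>i. g (\<gamma> i))) = g"
    by (rule ext) (simp only: ev_tensor_of endo_expansion[OF assms, symmetric])
  then show ?thesis by (simp add: fiber_def tensor_of_in_reps)
qed

lemma fiber_eq_cls: "f \<in> fiber g \<Longrightarrow> fiber g = cls \<iota> f"
  using cls_eq_fiber[of f] by (simp add: fiber_def)

lemma bij_betw_fiber: "bij_betw fiber (linear_endos \<iota>) (comp_carrier \<iota>)"
proof (rule bij_betw_imageI)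
  show "inj_on fiber (linear_endos \<iota>)"
  proof (rule inj_onI)
    fix g h assume "g \<in> linear_endos \<iota>" "fiber g = fiber h"
    then show "g = h" using tensor_of_in_fiber[of g] by (auto simp: fiber_def)
  qed
  show "fiber ` linear_endos \<iota> = comp_carrier \<iota>"
  proof safe
    fix g assume "g \<in> linear_endos \<iota>"
    from tensor_of_in_fiber[OF this] show "fiber g \<in> comp_carrier \<iota>"
      unfolding comp_carrier_def using fiber_eq_cls by (metis image_eqI tensor_of_in_reps)
  next
    fix A :: "('k, 'a) free_dual set" assume "A \<in> comp_carrier \<iota>"
    then obtain f where "f \<in> reps" "A = cls \<iota> f" by (auto simp: comp_carrier_def)
    then show "A \<in> fiber ` linear_endos \<iota>" using cls_eq_fiber ev_linear by blast
  qed
qed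

lemma fiber_mult:
  assumes g: "g \<in> linear_endos \<iota>" and h: "h \<in> linear_endos \<iota>"
  shows "comp_mult \<iota> (fiber g) (fiber h) = fiber (g \<circ> h)"
proof -
  obtain f f' where f: "f \<in> fiber g" "f' \<in> fiber h" using tensor_of_in_fiber g h by blast
  then have ff: "f \<in> reps" "f' \<in> reps" "ev f = g" "ev f' = h" by (auto simp: fiber_def)
  show ?thesis
    using comp_mult_cls[OF embedding ff(1,2)] cls_eq_fiber[OF free_mult_in_reps[OF ff(1,2)]]
    by (simp add: fiber_eq_cls[OF f(1)] fiber_eq_cls[OF f(2)] ev_free_mult[OF ff(1,2)] ff)
qed

lemma ex_rep:
  assumes "g \<in> linear_endos \<iota>"
  shows "\<exists>f \<in> reps. ev f = g"
  using tensor_of_in_fiber[OF assms] by (auto simp: fiber_def)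

lemma fiber_add:
  assumes g: "g \<in> linear_endos \<iota>" and h: "h \<in> linear_endos \<iota>"
  shows "fiber g \<oplus>\<^bsub>composition_algebra \<iota>\<^esub> fiber h = fiber (\<lambda>x. g x + h x)"
proof -
  have "cls \<iota> (f + f') = fiber (\<lambda>x. g x + h x)" if "f \<in> fiber g" "f' \<in> fiber h" for f f'
    using that cls_eq_fiber[OF V.subspace_add[OF subspace_reps, of f f']]
    by (auto simp: fiber_def fun_eq_iff ev_add[abs_def])
  moreover have "fiber g \<noteq> {}" "fiber h \<noteq> {}" using ex_rep g h by (auto simp: fiber_def)
  ultimately show ?thesis by (auto simp: composition_algebra_def)
qed

lemma fiber_smult:
  assumes g: "g \<in> linear_endos \<iota>"
  shows "c \<odot>\<^bsub>composition_algebra \<iota>\<^esub> fiber g = fiber (\<lambda>x. \<iota> c * g x)"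
proof -
  have "cls \<iota> (free_scale c f) = fiber (\<lambda>x. \<iota> c * g x)" if "f \<in> fiber g" for f
    using that cls_eq_fiber[OF V.subspace_scale[OF subspace_reps, of f c]]
    by (auto simp: fiber_def fun_eq_iff ev_scale[abs_def])
  moreover have "fiber g \<noteq> {}" using ex_rep g by (auto simp: fiber_def)
  ultimately show ?thesis by (auto simp: composition_algebra_def)
qed

lemma fiber_zero: "fiber (\<lambda>x. 0) = \<zero>\<^bsub>composition_algebra \<iota>\<^esub>"
  using cls_eq_fiber[OF V.subspace_0[OF subspace_reps]]
  by (simp add: composition_algebra_def ev_0[abs_def])

text \<open>
  The unit of the composition algebra is singled out as the unique two-sided identity; the class
  of the identity map is one, and two-sided identities are unique.
\<close>
lemma fiber_one: "fiber id = \<one>\<^bsub>composition_algebra \<iota>\<^esub>"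
proof -
  have id: "id \<in> linear_endos \<iota>" by (simp add: linear_endos_def)
  have img: "comp_carrier \<iota> = fiber ` linear_endos \<iota>"
    using bij_betw_fiber by (simp add: bij_betw_def)
  have unit: "comp_mult \<iota> (fiber id) A = A \<and> comp_mult \<iota> A (fiber id) = A"
    if "A \<in> comp_carrier \<iota>" for A
    using that by (auto simp: img fiber_mult id)
  have "(THE e. e \<in> comp_carrier \<iota> \<and>
      (\<forall>A\<in>comp_carrier \<iota>. comp_mult \<iota> e A = A \<and> comp_mult \<iota> A e = A)) = fiber id"
  proof (rule the_equality)
    show "fiber id \<in> comp_carrier \<iota> \<and>
        (\<forall>A\<in>comp_carrier \<iota>. comp_mult \<iota> (fiber id) A = A \<and> comp_mult \<iota> A (fiber id) = A)"
      using unit id by (simp add: img)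
  next
    fix e
    assume e: "e \<in> comp_carrier \<iota> \<and>
      (\<forall>A\<in>comp_carrier \<iota>. comp_mult \<iota> e A = A \<and> comp_mult \<iota> A e = A)"
    have "fiber id \<in> comp_carrier \<iota>" using id by (simp add: img)
    then have "comp_mult \<iota> e (fiber id) = fiber id" using e by blast
    then show "e = fiber id" using unit e by metis
  qed
  then show ?thesis by (simp add: composition_algebra_def)
qed

lemma fiber_iso: "fiber \<in> algebra_iso (endo_algebra \<iota>) (composition_algebra \<iota>)"
proof -
  have "carrier (composition_algebra \<iota>) = comp_carrier \<iota>"
    "mult (composition_algebra \<iota>) = comp_mult \<iota>"
    by (simp_all add: composition_algebra_def)
  then show ?thesis
    using bij_betw_fiber bij_betwE[OF bij_betw_fiber]
    by (auto simp: algebra_iso_def ring_iso_def ring_hom_def fiber_mult fiber_add fiber_smult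
        fiber_one)
qed

lemma finsum_fiber:
  assumes "finite S" "\<And>i. i \<in> S \<Longrightarrow> g i \<in> linear_endos \<iota>"
  shows "(\<Oplus>\<^bsub>composition_algebra \<iota>\<^esub> i\<in>S. fiber (g i)) = fiber (\<lambda>x. \<Sum>i\<in>S. g i x)"
proof -
  interpret E: ring "endo_algebra \<iota>" by (rule ring_endo_algebra)
  interpret C: ring "composition_algebra \<iota>"
    using E.ring_iso_imp_img_ring[OF algebra_isoD(1)[OF fiber_iso]] by (simp add: fiber_zero)
  have mem: "fiber g \<in> carrier (composition_algebra \<iota>)" if "g \<in> linear_endos \<iota>" for g
    using bij_betwE[OF bij_betw_fiber] that by (simp add: composition_algebra_def)
  show ?thesis
    using assms
  proof (induction S rule: finite_induct)
    case (insert i S)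
    have "(\<lambda>x. \<Sum>i\<in>S. g i x) \<in> linear_endos \<iota>"
      using insert.prems by (simp add: linear_endos_def sum.distrib sum_distrib_left)
    with insert show ?case by (simp add: C.finsum_insert mem fiber_add)
  qed (simp add: fiber_zero)
qed

lemma pure_tensor_\<tau>: "pure_tensor \<iota> (\<tau> i) x = fiber (\<lambda>y. \<iota> (\<tau> i y) * x)"
  using cls_eq_fiber[OF gen_in_reps[OF \<tau>_in_dual, of i x]] by (simp add: pure_tensor_def ev_gen[abs_def])

text \<open>The endomorphism that the tensor \<open>\<Sum>i. \<tau> i \<otimes> \<alpha> i\<close> stands for.\<close>
definition expand :: "(nat \<Rightarrow> 'a) \<Rightarrow> 'a \<Rightarrow> 'a" where
  "expand \<alpha> y = (\<Sum>i<n. \<iota> (\<tau> i y) * \<alpha> i)"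

text \<open>
  The sums in \<open>V_set\<close> are taken in the composition algebra; as \<open>fiber\<close> is additive, they are the
  classes of pointwise sums.
\<close>
lemma finsum_pure_tensor:
  "(\<Oplus>\<^bsub>composition_algebra \<iota>\<^esub> i\<in>{..<n}. pure_tensor \<iota> (\<tau> i) (\<alpha> i)) = fiber (expand \<alpha>)"
proof -
  have "(\<lambda>y. \<iota> (\<tau> i y) * \<alpha> i) \<in> linear_endos \<iota>" for i
    by (simp add: linear_endos_def \<tau>_add \<tau>_scale distrib_right mult.assoc)
  then show ?thesis
    by (simp add: pure_tensor_\<tau> finsum_fiber expand_def[abs_def])
qed

lemma expand_linear: "expand \<alpha> \<in> linear_endos \<iota>"
  by (simp add: linear_endos_def expand_def \<tau>_add \<tau>_scale distrib_right sum.distrib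
      sum_distrib_left mult.assoc)

lemma expand_endo: "g \<in> linear_endos \<iota> \<Longrightarrow> expand (\<lambda>i. g (\<gamma> i)) = g"
  by (rule ext) (simp only: expand_def endo_expansion[symmetric])

lemma expand_\<gamma>:
  assumes "i < n"
  shows "expand \<alpha> (\<gamma> i) = \<alpha> i"
proof -
  have "expand \<alpha> (\<gamma> i) = (\<Sum>j<n. if j = i then \<alpha> j else 0)"
    unfolding expand_def using assms by (intro sum.cong) (auto simp: \<tau>_\<gamma>)
  then show ?thesis using assms by simp
qed

text \<open>
  The exponents of the dual basis add up under Frobenius, so a map that commutes with
  \<open>x \<mapsto> x\<^bsup>q^m\<^esup>\<close> is determined by its values at \<open>\<gamma> 0, \<dots>, \<gamma> (m - 1)\<close>, the others being the
  conjugates \<open>g (\<gamma> (j m + k)) = g (\<gamma> k)\<^bsup>q^(jm)\<^esup>\<close>. Conversely, commutation may be checked on the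
  basis \<open>\<gamma>\<close>: there \<open>x \<mapsto> x\<^bsup>q^m\<^esup>\<close> moves each block of \<open>m\<close> indices to the next one, and the
  last block to the first by \<open>x\<^bsup>q^n\<^esup> = x\<close>.
\<close>
lemma expand_commutes_iff:
  assumes n: "n = m * t" and m: "m > 0"
  shows "expand \<alpha> \<in> frobenius_endos m \<longleftrightarrow>
    (\<forall>j<t. \<forall>k<m. \<alpha> (j * m + k) = \<alpha> k ^ (q ^ (j * m)))"
proof
  let ?g = "expand \<alpha>"
  have index: "j * m + k < n" if "j < t" "k < m" for j k
  proof -
    have "j * m + k < Suc j * m" using that by simp
    also have "\<dots> \<le> t * m" using that by (intro mult_right_mono) auto
    finally show ?thesis by (simp add: n mult.commute)
  qed
  have shift: "\<gamma> (j * m + k) = \<gamma> k ^ (q ^ (j * m))" for j k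
    using \<gamma>_add[of k "j * m"] by (simp add: add.commute)
  {
    assume g: "?g \<in> frobenius_endos m"
    have pow: "?g (x ^ (q ^ (j * m))) = ?g x ^ (q ^ (j * m))" for j x
    proof (induction j)
      case (Suc j)
      have "?g ((x ^ (q ^ (j * m))) ^ (q ^ m)) = (?g x ^ (q ^ (j * m))) ^ (q ^ m)"
        using g Suc by (simp add: frobenius_endos_def)
      then show ?case by (simp add: frobenius_frobenius add.commute)
    qed simp
    show "\<forall>j<t. \<forall>k<m. \<alpha> (j * m + k) = \<alpha> k ^ (q ^ (j * m))"
    proof (intro allI impI)
      fix j k assume jk: "j < t" "k < m"
      then have "k < n" using index[of 0 k] by simp
      then show "\<alpha> (j * m + k) = \<alpha> k ^ (q ^ (j * m))"
        using pow[of "\<gamma> k" j] expand_\<gamma>[OF index[OF jk]] by (simp add: shift expand_\<gamma>)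
    qed
  next
    assume \<alpha>: "\<forall>j<t. \<forall>k<m. \<alpha> (j * m + k) = \<alpha> k ^ (q ^ (j * m))"
    have basis: "?g (\<gamma> i ^ (q ^ m)) = ?g (\<gamma> i) ^ (q ^ m)" if i: "i < n" for i
    proof -
      define j k where "j = i div m" and "k = i mod m"
      have jk: "i = j * m + k" "k < m" "j < t"
        using m i by (auto simp: j_def k_def n less_mult_imp_div_less mult.commute)
      have k: "k < n" using index[of 0 k] jk by simp
      have \<alpha>i: "\<alpha> i ^ (q ^ m) = \<alpha> k ^ (q ^ (Suc j * m))"
        using \<alpha> jk by (simp add: frobenius_frobenius add.commute)
      have \<gamma>i: "\<gamma> i ^ (q ^ m) = \<gamma> (Suc j * m + k)"
        by (simp add: jk(1) flip: \<gamma>_add) (simp add: algebra_simps)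
      have "?g (\<gamma> (Suc j * m + k)) = \<alpha> k ^ (q ^ (Suc j * m))"
      proof (cases "Suc j < t")
        case True
        then show ?thesis using \<alpha> jk(2) expand_\<gamma>[OF index[OF True jk(2)]] by metis
      next
        case False
        then have "Suc j = t" using jk(3) by simp
        then have t: "Suc j * m = n" using n by (metis mult.commute)
        have "\<gamma> (n + k) = \<gamma> k" using \<gamma>_add[of k n] frobenius_n[of "\<gamma> k" 0] by (simp add: add.commute)
        then show ?thesis using frobenius_n[of "\<alpha> k" 0] expand_\<gamma>[OF k] by (simp only: t) simp
      qed
      then show ?thesis by (simp only: \<gamma>i \<alpha>i expand_\<gamma>[OF i])
    qed
    have lin: "?g \<in> linear_endos \<iota>" by (rule expand_linear)
    have "?g (x ^ (q ^ m)) = ?g x ^ (q ^ m)" for x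
    proof -
      define c where "c = (\<lambda>j. \<tau> j x)"
      have x: "x = (\<Sum>j<n. \<iota> (c j) * \<gamma> j)" unfolding c_def by (rule dual_basis_expansion)
      have "?g (x ^ (q ^ m)) = (\<Sum>j<n. \<iota> (c j) * ?g (\<gamma> j ^ (q ^ m)))"
        unfolding x by (simp add: frobenius_sum power_mult_distrib linear_endosD[OF lin])
      also have "\<dots> = (\<Sum>j<n. \<iota> (c j) * ?g (\<gamma> j) ^ (q ^ m))"
        by (simp add: basis)
      also have "\<dots> = ?g x ^ (q ^ m)"
        unfolding x by (simp add: frobenius_sum power_mult_distrib linear_endosD[OF lin])
      finally show ?thesis .
    qed
    then show "?g \<in> frobenius_endos m" using lin by (simp add: frobenius_endos_def)
  }
qed

lemma fiber_frobenius_endos: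
  assumes n: "n = m * t" and m: "m > 0"
  shows "fiber ` frobenius_endos m = V_set \<iota> m t \<beta>"
proof -
  have "V_set \<iota> m t \<beta> = {fiber (expand \<alpha>) | \<alpha>. expand \<alpha> \<in> frobenius_endos m}"
    unfolding V_set_def card_base n[symmetric] \<tau>_def[symmetric] finsum_pure_tensor
      expand_commutes_iff[OF assms] ..
  also have "\<dots> = fiber ` frobenius_endos m"
  proof safe
    fix g assume g: "g \<in> frobenius_endos m"
    then have "g \<in> linear_endos \<iota>" by (simp add: frobenius_endos_def)
    from expand_endo[OF this] g
    show "\<exists>\<alpha>. fiber g = fiber (expand \<alpha>) \<and> expand \<alpha> \<in> frobenius_endos m" by metis
  qed auto
  finally show ?thesis ..
qed

end

section \<open>The isomorphism\<close>

theorem theorem6p2: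
  fixes q n m t :: nat
    and \<iota> :: "'k::{field,finite} \<Rightarrow> 'a::{field,finite}"
    and \<beta> :: 'a
  assumes "primepow q" and "m \<ge> 1" and "t \<ge> 1" and "n = m * t"
    and "CARD('k) = q" and "CARD('a) = q ^ n" and "field_embedding \<iota>"
    and "normal_basis_generator \<iota> n \<beta>"
  shows "is_subalgebra (linearized_polys q n (subfield_of_order (q ^ m))) (linearized_algebra \<iota> n) \<and>
    is_subalgebra (V_set \<iota> m t \<beta>) (composition_algebra \<iota>) \<and>
    (\<exists>\<phi>. \<phi> \<in> algebra_iso
       ((linearized_algebra \<iota> n)
          \<lparr>carrier := linearized_polys q n (subfield_of_order (q ^ m))\<rparr>)
       ((composition_algebra \<iota>) \<lparr>carrier := V_set \<iota> m t \<beta>\<rparr>))"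
proof -
  interpret normal_basis_extension \<iota> q n \<beta>
    by unfold_locales (use assms in auto)
  have m: "m > 0" using assms(2) by simp
  note sub = subalgebra_frobenius_endos[of m] and E = ring_endo_algebra[of \<iota>]
  note L = interp_frobenius_endos[of m] and V = fiber_frobenius_endos[OF assms(4) m]
  have "is_subalgebra (interp ` frobenius_endos m) (linearized_algebra \<iota> n)"
    by (rule is_subalgebra_image[OF E _ interp_iso sub]) (simp add: interp_zero)
  moreover have "is_subalgebra (fiber ` frobenius_endos m) (composition_algebra \<iota>)"
    by (rule is_subalgebra_image[OF E _ fiber_iso sub]) (simp add: fiber_zero)
  ultimately show ?thesis
    using ex_iso_of_images[OF E sub interp_iso fiber_iso] by (simp only: L V)
qed

end
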